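(* Let $a_j,b_j\in\mathbb{R}$, $j=1,\dots,r$, set $a=\sum_{j=1}^ra_j$, and let $$\widetilde\phi_h=\phi^{(P)}_{b_rh}\circ\phi^{(U)}_{a_rh}\circ\cdots\circ\phi^{(P)}_{b_1h}\circ\phi^{(U)}_{a_1h}$$ be the splitting integrator for the system $\frac{d}{dt}(y,\theta)=(0,\omega)+f(y,\theta)$, where $\phi^{(U)}_t$ and $\phi^{(P)}_t$ are the exact $t$-flows of $\frac{d}{dt}(y,\theta)=(0,\omega)$ and of $\frac{d}{dt}(y,\theta)=f(y,\theta)$ respectively. Let $\phi_h$ be the exact $h$-flow of the full system. Then the local error of the splitting integrator possesses the (formal) expansion $$\widetilde\phi_h(x)-\phi_h(x)=\overline{W}_{(h(a-1)\omega,\ \widetilde\alpha(h)-\alpha(h))}(x),$$ i.e. $$\widetilde\phi_h(x_0)-\phi_h(x_0)=\begin{bmatrix}0\\ h(a-1)\omega\end{bmatrix}+\sum_{n=1}^\infty h^n\sum_{\mathbf{k}_1,\dots,\mathbf{k}_n\in\mathbb{Z}^d}\big(\widetilde A_{\mathbf{k}_1\cdots\mathbf{k}_n}(h)-A_{\mathbf{k}_1\cdots\mathbf{k}_n}(h)\big)f_{\mathbf{k}_1\cdots\mathbf{k}_n}(x_0).$$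
   Context: **Setting.** Let $0<d\le D$ be integers and $x=(y,\theta)$ with $y\in\mathbb{R}^{D-d}$ and $\theta\in\mathbb{R}^d$ a vector of angles; $\omega\in\mathbb{R}^d$ has components $\omega_j>0$. The perturbation $f(y,\theta)=\sum_{\mathbf{k}\in\mathbb{Z}^d}f_{\mathbf{k}}(y,\theta)$ is smooth, $\mathbb{R}^D$-valued and $2\pi$-periodic in each component of $\theta$, with $f_{\mathbf{k}}(y,\theta)=\exp(i\mathbf{k}\cdot\theta)\hat f_{\mathbf{k}}(y)$, where the $\hat f_{\mathbf{k}}$ are $\mathbb{C}^D$-valued Fourier coefficients ($\hat f_{-\mathbf{k}}$ is the complex conjugate of $\hat f_{\mathbf{k}}$). **Words and series.** $\mathcal{W}$ is the set of words $\mathbf{k}_1\cdots\mathbf{k}_n$, $n\ge0$, over the alphabet $\mathbb{Z}^d$; $\emptyset$ is the empty word. The word-basis functions are $f_\emptyset(x)=x$, $f_{\mathbf{k}}(x)=f_{\mathbf{k}}(y,\theta)=\exp(i\mathbf{k}\cdot\theta)\hat f_{\mathbf{k}}(y)$ for one letter, and $f_{\mathbf{k}_1\cdots\mathbf{k}_n}(x)=\big(\partial_xf_{\mathbf{k}_2\cdots\mathbf{k}_n}(x)\big)f_{\mathbf{k}_1}(x)$ for $n>1$ ($\partial_x$ is the Jacobian with respect to $x=(y,\theta)$). For $v\in\mathbb{C}^d$ and $\delta:\mathcal{W}\to\mathbb{C}$, $w\mapsto\delta_w$, the extended word series is the formal series $\overline{W}_{(v,\delta)}(x)=\begin{bmatrix}0\\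 v\end{bmatrix}+\sum_{w\in\mathcal{W}}\delta_wf_w(x)$. Expansions are formal: with $\epsilon f_{\mathbf{k}}$ in place of $f_{\mathbf{k}}$ they are formal power series in $\epsilon$, words with $n$ letters contributing to $\epsilon^n$ (the sum over the infinitely many words of $n$ letters is itself formal). **Coefficients of the exact flow.** $\alpha_\emptyset(h)=1$ and $\alpha_{\mathbf{k}_1\cdots\mathbf{k}_n}(h)=h^nA_{\mathbf{k}_1\cdots\mathbf{k}_n}(h)$, where $$A_{\mathbf{k}_1\cdots\mathbf{k}_n}(h)=\int\cdots\int_{0\le t_1\le\cdots\le t_n\le1}\exp\big(i(t_1\mathbf{k}_1+\cdots+t_n\mathbf{k}_n)\cdot\omega h\big)\,dt_1\cdots dt_n.$$ The exact flow has the formal expansion $\phi_h(x)=\overline{W}_{(h\omega,\alpha(h))}(x)$. **Coefficients of the integrator.** $\widetilde\alpha_\emptyset(h)=1$ and $\widetilde\alpha_{\mathbf{k}_1\cdots\mathbf{k}_n}(h)=h^n\widetilde A_{\mathbf{k}_1\cdots\mathbf{k}_n}(h)$, where $$\widetilde A_{\mathbf{k}_1\cdots\mathbf{k}_n}(h)=\sum_{1\le j_1\le\cdots\le j_n\le r}\frac{b_{j_1}\cdots b_{j_n}}{\sigma_{j_1\cdots j_n}}\exp\big(i(c_{j_1}\mathbf{k}_1+\cdots+c_{j_n}\mathbf{k}_n)\cdot\omega h\big),$$ $c_j=a_1+\cdots+a_j$, $\sigma_{j_1\cdots j_n}=n!$ if $j_1=\cdots=j_n$, and $\sigma_{j_1\cdots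 j_n}=\ell!\,\sigma_{j_{\ell+1}\cdots j_n}$ if $\ell<n$ and $j_1=\cdots=j_\ell<j_{\ell+1}\le\cdots\le j_n$. The expansion of $\widetilde\phi_h$ is obtained by composing, by formal substitution, the expansions of the split flows, namely $\phi_t^{(U)}(x)=x+(0,t\omega)$ and the Taylor expansion $\phi^{(P)}_t(x)=\sum_{w\in\mathcal{W}}\frac{t^{|w|}}{|w|!}f_w(x)$, with $|w|$ the number of letters of $w$. *)

theory Defs
  imports "HOL-Analysis.Analysis" "HOL-Library.Multiset"
begin

text \<open>
  The state space is \<open>real^'n\<close> with \<open>D = CARD('n)\<close>; an injection \<open>\<iota> :: 'd \<Rightarrow> 'n\<close> selects the
  \<open>d = CARD('d)\<close> angle coordinates \<open>\<theta>\<close>, and the coordinates outside \<open>range \<iota>\<close> form \<open>y\<close>.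
  In this way every pair \<open>0 < d \<le> D\<close> is covered, including \<open>d = D\<close> (no \<open>y\<close>), which a
  product \<open>(real^'m) \<times> (real^'d)\<close> would exclude because types are not empty.
\<close>

definition angles :: "('d::finite \<Rightarrow> 'n::finite) \<Rightarrow> real^'n \<Rightarrow> real^'d" where
  "angles \<iota> x = (\<chi> j. x $ \<iota> j)"

definition with_angles :: "('d::finite \<Rightarrow> 'n::finite) \<Rightarrow> real^'n \<Rightarrow> real^'d \<Rightarrow> real^'n" where
  "with_angles \<iota> x \<theta> = (\<chi> i. if i \<in> range \<iota> then \<theta> $ inv \<iota> i else x $ i)"

text \<open>The block vector with \<open>y\<close>-part \<open>0\<close> and \<open>\<theta>\<close>-part \<open>v\<close>.\<close>

definition angle_vec :: "('d::finite \<Rightarrow> 'n::finite) \<Rightarrow> 'a::zero^'d \<Rightarrow> 'a^'n" where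
  "angle_vec \<iota> v = (\<chi> i. if i \<in> range \<iota> then v $ inv \<iota> i else 0)"

definition cvec :: "real^'n::finite \<Rightarrow> complex^'n" where
  "cvec x = (\<chi> i. complex_of_real (x $ i))"

definition freq :: "int^'d::finite \<Rightarrow> real^'d" where
  "freq k = (\<chi> j. real_of_int (k $ j))"

primrec times_differentiable ::
  "nat \<Rightarrow> ('a::euclidean_space \<Rightarrow> 'b::real_normed_vector) \<Rightarrow> bool" where
  "times_differentiable 0 g \<longleftrightarrow> continuous_on UNIV g"
| "times_differentiable (Suc n) g \<longleftrightarrow> (\<forall>x. g differentiable (at x)) \<and>
     (\<forall>v. times_differentiable n (\<lambda>x. frechet_derivative g (at x) v))"

definition smooth :: "('a::euclidean_space \<Rightarrow> 'b::real_normed_vector) \<Rightarrow> bool" where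
  "smooth g \<longleftrightarrow> (\<forall>n. times_differentiable n g)"

definition angle_periodic ::
  "('d::finite \<Rightarrow> 'n::finite) \<Rightarrow> (real^'n \<Rightarrow> 'b) \<Rightarrow> bool" where
  "angle_periodic \<iota> f \<longleftrightarrow> (\<forall>x j. f (x + axis (\<iota> j) (2 * pi)) = f x)"


section \<open>Word-basis functions\<close>

text \<open>The Fourier coefficient depends on \<open>x = (y, \<theta>)\<close> through \<open>y\<close> only.\<close>

definition fourier_coeff ::
  "('d::finite \<Rightarrow> 'n::finite) \<Rightarrow> (real^'n \<Rightarrow> real^'n) \<Rightarrow> int^'d \<Rightarrow> real^'n \<Rightarrow> complex^'n" where
  "fourier_coeff \<iota> f k x =
     (1 / (2 * pi) ^ CARD('d)) *\<^sub>R
       integral (cbox 0 (\<chi> j. 2 * pi))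
         (\<lambda>\<theta>. exp (- \<i> * complex_of_real (freq k \<bullet> \<theta>)) *s cvec (f (with_angles \<iota> x \<theta>)))"

definition letter_fun ::
  "('d::finite \<Rightarrow> 'n::finite) \<Rightarrow> (real^'n \<Rightarrow> real^'n) \<Rightarrow> int^'d \<Rightarrow> real^'n \<Rightarrow> complex^'n" where
  "letter_fun \<iota> f k x =
     exp (\<i> * complex_of_real (freq k \<bullet> angles \<iota> x)) *s fourier_coeff \<iota> f k x"

definition partial_deriv ::
  "'n::finite \<Rightarrow> (real^'n \<Rightarrow> complex^'m::finite) \<Rightarrow> real^'n \<Rightarrow> complex^'m" where
  "partial_deriv i g x = frechet_derivative g (at x) (axis i 1)"

definition jacobian_mat ::
  "(real^'n::finite \<Rightarrow> complex^'m::finite) \<Rightarrow> real^'n \<Rightarrow> complex^'n^'m" where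
  "jacobian_mat g x = (\<chi> a b. partial_deriv b g x $ a)"

fun word_fun ::
  "('d::finite \<Rightarrow> 'n::finite) \<Rightarrow> (real^'n \<Rightarrow> real^'n) \<Rightarrow> (int^'d) list \<Rightarrow> real^'n \<Rightarrow> complex^'n" where
  "word_fun \<iota> f [] x = cvec x"
| "word_fun \<iota> f [k] x = letter_fun \<iota> f k x"
| "word_fun \<iota> f (k # l # w) x = jacobian_mat (word_fun \<iota> f (l # w)) x *v letter_fun \<iota> f k x"


section \<open>Formal expansions\<close>

text \<open>
  Each \<open>f\<^sub>k\<close> is replaced by \<open>\<epsilon>\<^sub>k f\<^sub>k\<close> with a separate commuting indeterminate \<open>\<epsilon>\<^sub>k\<close>
  per letter. A formal expansion is then a formal power series in the \<open>\<epsilon>\<^sub>k\<close> whose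
  coefficients are functions of \<open>x\<close>; the monomials are the finite multisets of letters. A word
  contributes to the monomial \<open>mset w\<close>, so that every coefficient is a finite sum, and the
  coefficient of \<open>\<epsilon>^n\<close> in the one-parameter expansion (\<open>\<epsilon>\<^sub>k = \<epsilon>\<close> for all \<open>k\<close>) is the
  formal sum of the coefficients at all multisets of size \<open>n\<close>.
\<close>

type_synonym ('d, 'n) fexp = "(int^'d) multiset \<Rightarrow> real^'n \<Rightarrow> complex^'n"

definition word_series ::
  "('d::finite \<Rightarrow> 'n::finite) \<Rightarrow> (real^'n \<Rightarrow> real^'n) \<Rightarrow>
     complex^'d \<Rightarrow> ((int^'d) list \<Rightarrow> complex) \<Rightarrow> ('d, 'n) fexp" where
  "word_series \<iota> f v \<delta> = (\<lambda>M x.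
     (if M = {#} then angle_vec \<iota> v else 0) + (\<Sum>w | mset w = M. \<delta> w *s word_fun \<iota> f w x))"

definition fexp_id :: "('d::finite, 'n::finite) fexp" where
  "fexp_id = (\<lambda>M x. if M = {#} then cvec x else 0)"

text \<open>
  Formal substitution \<open>F \<circ> G\<close> by Taylor expansion about the zeroth-order term of \<open>G\<close>: with
  \<open>G(x) = G\<^sub>0(x) + \<Sum>\<^sub>L \<epsilon>\<^sup>L G\<^sub>L(x)\<close> (nonempty \<open>L\<close>),
  \<open>g(G(x)) = \<Sum>\<^sub>m 1/m! \<Sum> \<partial>\<^bsub>i1 \<dots> im\<^esub> g(G\<^sub>0(x)) \<epsilon>\<^bsup>L1 + \<dots> + Lm\<^esup> G\<^bsub>L1,i1\<^esub>(x) \<dots> G\<^bsub>Lm,im\<^esub>(x)\<close>,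
  summed over nonempty \<open>L1, \<dots>, Lm\<close> and indices \<open>i1, \<dots>, im\<close>. The lists \<open>Ls\<close>, \<open>is\<close> below collect
  these. Substitution is used only when \<open>G\<^sub>0\<close> is real valued; \<open>Re\<close> is merely the coercion back to
  the real state space. The other coefficients may be complex.
\<close>

definition base_point :: "('d::finite, 'n::finite) fexp \<Rightarrow> real^'n \<Rightarrow> real^'n" where
  "base_point G x = (\<chi> i. Re (G {#} x $ i))"

definition taylor_coeff ::
  "(real^'n::finite \<Rightarrow> complex^'n) \<Rightarrow> ('d::finite, 'n) fexp \<Rightarrow> (int^'d) multiset \<Rightarrow> real^'n \<Rightarrow> complex^'n" where
  "taylor_coeff g G L x =
     (\<Sum>Ls | {#} \<notin> set Ls \<and> sum_list Ls = L. \<Sum>is | length is = length Ls.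
        ((\<Prod>j<length Ls. G (Ls ! j) x $ (is ! j)) / fact (length Ls)) *s
          foldr partial_deriv is g (base_point G x))"

definition fexp_subst ::
  "('d::finite, 'n::finite) fexp \<Rightarrow> ('d, 'n) fexp \<Rightarrow> ('d, 'n) fexp" where
  "fexp_subst F G = (\<lambda>M x. \<Sum>N | N \<subseteq># M. taylor_coeff (F N) G (M - N) x)"

text \<open>The index sets in the definitions above are finite, so the sums are not silently zero.\<close>

lemma finite_words_of_content: "finite {w. mset w = M}"
proof -
  have "{w. mset w = M} \<subseteq> {w. set w \<subseteq> set_mset M \<and> length w = size M}"
    by auto
  thus ?thesis
    using finite_lists_length_eq[of "set_mset M" "size M"] finite_subset by blast
qed

lemma finite_submultisets: "finite {N. N \<subseteq># M}"
proof -
  have "{N. N \<subseteq># M} \<subseteq> mset ` (\<Union>l\<le>size M. {w. set w \<subseteq> set_mset M \<and> length w = l})"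
  proof
    fix N assume "N \<in> {N. N \<subseteq># M}"
    moreover obtain w where "N = mset w" by (metis ex_mset)
    ultimately show "N \<in> mset ` (\<Union>l\<le>size M. {w. set w \<subseteq> set_mset M \<and> length w = l})"
      using set_mset_mono size_mset_mono by fastforce
  qed
  thus ?thesis
    by (rule finite_subset) (auto intro: finite_lists_length_eq)
qed

lemma finite_ordered_partitions: "finite {Ls. {#} \<notin> set Ls \<and> sum_list Ls = (L :: 'a multiset)}"
proof -
  have len: "length Ls \<le> size (sum_list Ls)" if "{#} \<notin> set Ls" for Ls :: "'a multiset list"
    using that
  proof (induction Ls)
    case (Cons K Ls)
    then have "1 \<le> size K"
      by (simp add: Suc_le_eq nonempty_has_size)
    with Cons show ?case by simp
  qed simp
  have sub: "K \<subseteq># sum_list Ls" if "K \<in> set Ls" for K and Ls :: "'a multiset list"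
    using that by (induction Ls) (auto intro: subset_mset.add_increasing subset_mset.add_increasing2)
  have "{Ls. {#} \<notin> set Ls \<and> sum_list Ls = L} \<subseteq> (\<Union>l\<le>size L. {Ls. set Ls \<subseteq> {N. N \<subseteq># L} \<and> length Ls = l})"
    using len sub by fastforce
  thus ?thesis
    by (rule finite_subset) (auto intro: finite_lists_length_eq finite_submultisets)
qed

lemma finite_index_lists: "finite {is :: 'n::finite list. length is = m}"
  using finite_lists_length_eq[of "UNIV :: 'n set" m] by simp


section \<open>Formal flows\<close>

text \<open>
  \<open>\<Phi>\<close> is the formal expansion of the flow of the formal vector field \<open>V\<close>: it solves
  \<open>d/dt \<Phi>\<^sub>t = V(\<Phi>\<^sub>t)\<close>, \<open>\<Phi>\<^sub>0 = id\<close>, coefficient by coefficient. For the vector fields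
  below this determines \<open>\<Phi>\<close> uniquely and makes its zeroth-order term real.
\<close>

definition formal_flow ::
  "('d::finite, 'n::finite) fexp \<Rightarrow> (real \<Rightarrow> ('d, 'n) fexp) \<Rightarrow> bool" where
  "formal_flow V \<Phi> \<longleftrightarrow> \<Phi> 0 = fexp_id \<and>
     (\<forall>t M x. ((\<lambda>s. \<Phi> s M x) has_vector_derivative fexp_subst V (\<Phi> t) M x) (at t))"

definition rotation_field ::
  "('d::finite \<Rightarrow> 'n::finite) \<Rightarrow> real^'d \<Rightarrow> ('d, 'n) fexp" where
  "rotation_field \<iota> \<omega> = (\<lambda>M x. if M = {#} then angle_vec \<iota> (cvec \<omega>) else 0)"

text \<open>The field \<open>f = \<Sum>\<^sub>k \<epsilon>\<^sub>k f\<^sub>k\<close>; the sum has at most one term.\<close>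

definition perturbation_field ::
  "('d::finite \<Rightarrow> 'n::finite) \<Rightarrow> (real^'n \<Rightarrow> real^'n) \<Rightarrow> ('d, 'n) fexp" where
  "perturbation_field \<iota> f = (\<lambda>M x. \<Sum>k | M = {#k#}. letter_fun \<iota> f k x)"

definition full_field ::
  "('d::finite \<Rightarrow> 'n::finite) \<Rightarrow> real^'d \<Rightarrow> (real^'n \<Rightarrow> real^'n) \<Rightarrow> ('d, 'n) fexp" where
  "full_field \<iota> \<omega> f = (\<lambda>M x. rotation_field \<iota> \<omega> M x + perturbation_field \<iota> f M x)"

text \<open>
  \<open>P\<^bsub>b r h\<^esub> \<circ> U\<^bsub>a r h\<^esub> \<circ> \<dots> \<circ> P\<^bsub>b 1 h\<^esub> \<circ> U\<^bsub>a 1 h\<^esub>\<close>; coefficients are indexed from 1.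
\<close>

primrec splitting ::
  "(real \<Rightarrow> ('d::finite, 'n::finite) fexp) \<Rightarrow> (real \<Rightarrow> ('d, 'n) fexp) \<Rightarrow>
     (nat \<Rightarrow> real) \<Rightarrow> (nat \<Rightarrow> real) \<Rightarrow> real \<Rightarrow> nat \<Rightarrow> ('d, 'n) fexp" where
  "splitting U P a b h 0 = fexp_id"
| "splitting U P a b h (Suc r) =
     fexp_subst (P (b (Suc r) * h)) (fexp_subst (U (a (Suc r) * h)) (splitting U P a b h r))"


section \<open>Coefficients\<close>

definition ordered_simplex :: "nat \<Rightarrow> (nat \<Rightarrow> real) set" where
  "ordered_simplex n = {t \<in> space (\<Pi>\<^sub>M j\<in>{..<n}. lborel).
     (\<forall>j<n. 0 \<le> t j \<and> t j \<le> 1) \<and> (\<forall>i<n. \<forall>j<n. i \<le> j \<longrightarrow> t i \<le> t j)}"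

definition A_exact :: "real^'d::finite \<Rightarrow> real \<Rightarrow> (int^'d) list \<Rightarrow> complex" where
  "A_exact \<omega> h w =
     (LINT t:ordered_simplex (length w)|(\<Pi>\<^sub>M j\<in>{..<length w}. lborel).
        exp (\<i> * complex_of_real (((\<Sum>j<length w. t j *\<^sub>R freq (w ! j)) \<bullet> \<omega>) * h)))"

definition alpha_exact :: "real^'d::finite \<Rightarrow> real \<Rightarrow> (int^'d) list \<Rightarrow> complex" where
  "alpha_exact \<omega> h w = (if w = [] then 1 else complex_of_real (h ^ length w) * A_exact \<omega> h w)"

text \<open>On a sorted list this is the product of the factorials of the lengths of its constant runs.\<close>

function run_factorial :: "nat list \<Rightarrow> nat" where
  "run_factorial [] = 1"
| "run_factorial (j # js) =
     fact (length (takeWhile (\<lambda>i. i = j) (j # js))) * run_factorial (dropWhile (\<lambda>i. i = j) (j # js))"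
  by pat_completeness auto
termination
  by (relation "Wellfounded.measure length") (auto simp: le_imp_less_Suc length_dropWhile_le)

definition A_split ::
  "real^'d::finite \<Rightarrow> (nat \<Rightarrow> real) \<Rightarrow> (nat \<Rightarrow> real) \<Rightarrow> nat \<Rightarrow> real \<Rightarrow> (int^'d) list \<Rightarrow> complex" where
  "A_split \<omega> a b r h w =
     (\<Sum>js | length js = length w \<and> sorted js \<and> set js \<subseteq> {1..r}.
        complex_of_real (prod_list (map b js) / real (run_factorial js)) *
        exp (\<i> * complex_of_real
          (((\<Sum>l<length w. (\<Sum>m=1..js ! l. a m) *\<^sub>R freq (w ! l)) \<bullet> \<omega>) * h)))"

definition alpha_split ::
  "real^'d::finite \<Rightarrow> (nat \<Rightarrow> real) \<Rightarrow> (nat \<Rightarrow> real) \<Rightarrow> nat \<Rightarrow> real \<Rightarrow> (int^'d) list \<Rightarrow> complex" where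
  "alpha_split \<omega> a b r h w =
     (if w = [] then 1 else complex_of_real (h ^ length w) * A_split \<omega> a b r h w)"

end

theory Submission
  imports Defs
begin

text \<open>
  The theorem compares two word series, so the task is to expand \<open>\<phi>\<^sub>h\<close> and the integrator as word
  series with the stated coefficients; the local error is then the difference of the two.

  What makes word series work is that substituting one into a word-basis function gives a word series
  again: \<open>f\<^sub>u(W\<^bsub>(v,\<delta>)\<^esub>(x)) = exp (i k\<^sub>u \<cdot> v) \<Sum>\<^sub>w \<delta>\<^sub>w f\<^bsub>wu\<^esub>(x)\<close>, where \<open>k\<^sub>u\<close> is the sum of the
  letters of \<open>u\<close>. The phase is there because \<open>f\<^sub>k\<close> depends on the angles only through
  \<open>exp (i k \<cdot> \<theta>)\<close> (\<open>word_fun_rotate\<close>). The rest is a property of \<open>\<delta>\<close>, here called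
  \<open>substitutive\<close>, which is usually derived from the shuffle relations. A differential equation
  replaces that combinatorics: if \<open>\<delta>\<^sub>t\<close> solves \<open>d/dt \<delta>\<^bsub>wk\<^esub> = \<rho>\<^sub>k(t) \<delta>\<^sub>w\<close> and is substitutive at
  \<open>t = 0\<close>, then both sides of the identity solve the same system, which is triangular in the size
  of the monomial, so they agree for all \<open>t\<close> (\<open>substitutive_evolution\<close>). The ingredients are a chain
  rule and a product rule for formal Taylor expansions (\<open>taylor_has_vector_derivative\<close>,
  \<open>taylor_product\<close>); the product rule itself follows from the chain rule by scaling the increment.

  All coefficients in question arise in this way. For the exact flow the rate is
  \<open>\<rho>\<^sub>k(t) = exp (i t k \<cdot> \<omega>)\<close>, since the largest integration variable of the simplex integral can be
  integrated last (\<open>alpha_exact_derivative\<close>). For the kick of a splitting stage (the flow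
  of the perturbation) the rate is
  \<open>exp (i k \<cdot> v)\<close>, with \<open>v\<close> the rotation accumulated so far. A rotation changes only the angle part
  \<open>v\<close>. The flow equations are triangular too, so their solutions are the corresponding word series
  (\<open>formal_flow_eq_word_series\<close>). Composing two word series convolves their coefficients over the
  cuts of a word into a left and a right part (\<open>fexp_subst_word_series\<close>), and the coefficients of the
  integrator satisfy the matching recursion in the number of stages, because a sorted list of stages
  is a shorter such list followed by a run of the last stage (\<open>alpha_split_Suc\<close>).
\<close>

section \<open>Smooth functions\<close>

lemma times_differentiable_continuous: "times_differentiable n g \<Longrightarrow> continuous_on UNIV g"
  by (cases n) (auto intro!: differentiable_imp_continuous_on differentiable_at_imp_differentiable_on)

lemma times_differentiable_Suc_imp: "times_differentiable (Suc n) g \<Longrightarrow> times_differentiable n g"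
proof (induction n arbitrary: g)
  case 0
  then show ?case using times_differentiable_continuous[of "Suc 0" g] by simp
next
  case (Suc n)
  then show ?case by (metis times_differentiable.simps(2))
qed

lemma smooth_imp_continuous: "smooth g \<Longrightarrow> continuous_on S g"
  unfolding smooth_def using times_differentiable.simps(1) continuous_on_subset by blast

lemma smooth_imp_differentiable: "smooth g \<Longrightarrow> g differentiable (at x)"
  unfolding smooth_def using times_differentiable.simps(2) by blast

lemma smooth_imp_has_derivative:
  "smooth g \<Longrightarrow> (g has_derivative frechet_derivative g (at x)) (at x)"
  using frechet_derivative_works smooth_imp_differentiable by blast

lemma smooth_directional: "smooth g \<Longrightarrow> smooth (\<lambda>x. frechet_derivative g (at x) v)"
  unfolding smooth_def using times_differentiable.simps(2) by blast

text \<open>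
  Smoothness asks for derivatives of every order, so it holds for each member of a class of
  differentiable functions that is closed under directional derivatives. For explicit families
  (exponentials, averages over the angles) such a class is easier to name than the iterated
  derivatives.
\<close>

lemma smooth_coinduct:
  assumes "P g"
    and step: "\<And>g. P g \<Longrightarrow> (\<forall>x. g differentiable (at x)) \<and> (\<forall>v. P (\<lambda>x. frechet_derivative g (at x) v))"
  shows "smooth g"
proof -
  have "times_differentiable n g" if "P g" for n g
    using that
  proof (induction n arbitrary: g)
    case 0
    then show ?case using step[OF 0]
      by (auto intro!: differentiable_imp_continuous_on differentiable_at_imp_differentiable_on)
  next
    case (Suc n)
    then show ?case using step[OF Suc.prems] by simp
  qed
  then show ?thesis using assms(1) unfolding smooth_def by blast
qed

lemma times_differentiable_add:
  "times_differentiable n g \<Longrightarrow> times_differentiable n h \<Longrightarrow> times_differentiable n (\<lambda>x. g x + h x)"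
proof (induction n arbitrary: g h)
  case 0
  then show ?case by (auto intro: continuous_on_add)
next
  case (Suc n)
  have "frechet_derivative (\<lambda>x. g x + h x) (at x) =
      (\<lambda>v. frechet_derivative g (at x) v + frechet_derivative h (at x) v)" for x
    using Suc.prems by (intro frechet_derivative_at[symmetric] has_derivative_add)
      (auto simp: frechet_derivative_works[symmetric])
  then show ?case using Suc by (auto intro: differentiable_add)
qed

lemma smooth_add: "smooth g \<Longrightarrow> smooth h \<Longrightarrow> smooth (\<lambda>x. g x + h x)"
  unfolding smooth_def using times_differentiable_add by blast

lemma smooth_const: "smooth (\<lambda>x. c)"
proof (rule smooth_coinduct[where P="\<lambda>g. \<exists>c. g = (\<lambda>x. c)"])
  show "\<exists>c'. (\<lambda>x. c) = (\<lambda>x. c')" by blast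
qed auto

lemma smooth_sum: "(\<And>i. i \<in> I \<Longrightarrow> smooth (g i)) \<Longrightarrow> smooth (\<lambda>x. \<Sum>i\<in>I. g i x)"
  by (induction I rule: infinite_finite_induct) (auto intro: smooth_add smooth_const)

text \<open>
  The Leibniz rule turns one derivative of the product into two products of lower order. Products
  alone are thus not closed under differentiation, hence an induction on the order together with
  the sum rule.
\<close>

lemma times_differentiable_bilinear:
  assumes "bounded_bilinear B"
  shows "times_differentiable n g \<Longrightarrow> times_differentiable n h \<Longrightarrow> times_differentiable n (\<lambda>x. B (g x) (h x))"
proof (induction n arbitrary: g h)
  case 0
  then show ?case by (auto intro: bounded_bilinear.continuous_on[OF assms])
next
  case (Suc n)
  have d: "((\<lambda>x. B (g x) (h x)) has_derivative
      (\<lambda>v. B (g x) (frechet_derivative h (at x) v) + B (frechet_derivative g (at x) v) (h x))) (at x)" for x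
    using Suc.prems by (intro bounded_bilinear.FDERIV[OF assms])
      (auto simp: frechet_derivative_works[symmetric])
  have e: "frechet_derivative (\<lambda>x. B (g x) (h x)) (at x) =
    (\<lambda>v. B (g x) (frechet_derivative h (at x) v) + B (frechet_derivative g (at x) v) (h x))" for x
    by (rule frechet_derivative_at[OF d, symmetric])
  have "times_differentiable n (\<lambda>x. B (g x) (frechet_derivative h (at x) v) + B (frechet_derivative g (at x) v) (h x))" for v
    using Suc.prems times_differentiable_Suc_imp[OF Suc.prems(1)] times_differentiable_Suc_imp[OF Suc.prems(2)]
    by (intro times_differentiable_add Suc.IH) auto
  then show ?case using d e by (auto intro: differentiableI)
qed

lemma smooth_bilinear:
  "bounded_bilinear B \<Longrightarrow> smooth g \<Longrightarrow> smooth h \<Longrightarrow> smooth (\<lambda>x. B (g x) (h x))"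
  unfolding smooth_def using times_differentiable_bilinear by blast

lemma bounded_bilinear_smult: "bounded_bilinear (\<lambda>c (v::complex^'n::finite). c *s v)"
  by (subst bilinear_conv_bounded_bilinear[symmetric])
     (auto simp: bilinear_def vec_eq_iff algebra_simps intro!: linearI)

lemma bounded_bilinear_nth_smult:
  "bounded_bilinear (\<lambda>(u::complex^'m::finite) (v::complex^'n::finite). (u $ i) *s v)"
  by (subst bilinear_conv_bounded_bilinear[symmetric])
     (auto simp: bilinear_def vec_eq_iff algebra_simps intro!: linearI)

lemma smooth_bounded_linear: assumes "bounded_linear L" shows "smooth L"
proof (rule smooth_coinduct[where P="\<lambda>g. bounded_linear g \<or> (\<exists>c. g = (\<lambda>x. c))"])
  fix g :: "'a \<Rightarrow> 'b" assume "bounded_linear g \<or> (\<exists>c. g = (\<lambda>x. c))"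
  moreover have "bounded_linear g \<Longrightarrow> frechet_derivative g (at x) = g" for x
    by (intro frechet_derivative_at[symmetric] bounded_linear_imp_has_derivative)
  ultimately show "(\<forall>x. g differentiable at x) \<and> (\<forall>v. bounded_linear (\<lambda>x. frechet_derivative g (at x) v) \<or>
           (\<exists>c. (\<lambda>x. frechet_derivative g (at x) v) = (\<lambda>x. c)))"
    by (auto intro: bounded_linear_imp_differentiable)
qed (use assms in auto)

section \<open>Symmetry of second derivatives\<close>

lemma smooth_line_derivative:
  assumes "smooth g"
  shows "((\<lambda>t. g (x + t *\<^sub>R v)) has_vector_derivative frechet_derivative g (at (x + t *\<^sub>R v)) v) (at t within S)"
proof -
  have "((\<lambda>t. x + t *\<^sub>R v) has_derivative (\<lambda>s. s *\<^sub>R v)) (at t within S)"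
    by (auto intro!: derivative_eq_intros)
  from has_derivative_compose[OF this smooth_imp_has_derivative[OF assms]]
  show ?thesis
    unfolding has_vector_derivative_def
    using linear_cmul[OF linear_frechet_derivative[OF smooth_imp_differentiable[OF assms]]] by simp
qed

text \<open>
  Write \<open>g(x + s u + t v) - g(x + s u)\<close> as the integral of the \<open>v\<close>-derivative over \<open>[0,t]\<close> and
  differentiate at \<open>s = 0\<close> under the integral sign: the increment of the \<open>u\<close>-derivative along \<open>v\<close> is
  the integral of the second derivative taken in the other order. Differentiating in \<open>t\<close> at \<open>0\<close>
  gives the symmetry.
\<close>

lemma frechet_derivative_symmetric:
  fixes g :: "'a::euclidean_space \<Rightarrow> 'b::banach"
  assumes g: "smooth g"
  shows "frechet_derivative (\<lambda>x. frechet_derivative g (at x) u) (at x) v =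
         frechet_derivative (\<lambda>x. frechet_derivative g (at x) v) (at x) u"
proof -
  define Du Dv where "Du = (\<lambda>x. frechet_derivative g (at x) u)" and "Dv = (\<lambda>x. frechet_derivative g (at x) v)"
  have sm: "smooth Du" "smooth Dv" unfolding Du_def Dv_def by (simp_all add: g smooth_directional)
  define Duv where "Duv = (\<lambda>x. frechet_derivative Dv (at x) u)"
  have smuv: "smooth Duv" unfolding Duv_def by (simp add: sm smooth_directional)
  have key: "Du (x + t *\<^sub>R v) - Du x = integral {0..t} (\<lambda>\<tau>. Duv (x + \<tau> *\<^sub>R v))" if t: "t \<in> {0..1}" for t
  proof -
    have ftc: "((\<lambda>\<tau>. Dv ((x + s *\<^sub>R u) + \<tau> *\<^sub>R v)) has_integral (g ((x + s *\<^sub>R u) + t *\<^sub>R v) - g ((x + s *\<^sub>R u) + 0 *\<^sub>R v))) {0..t}" for s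
      using t unfolding Dv_def
      by (intro fundamental_theorem_of_calculus smooth_line_derivative g) auto
    have lz: "((\<lambda>s. integral (cbox 0 t) (\<lambda>\<tau>. Dv ((x + s *\<^sub>R u) + \<tau> *\<^sub>R v))) has_vector_derivative
        integral (cbox 0 t) (\<lambda>\<tau>. Duv ((x + 0 *\<^sub>R u) + \<tau> *\<^sub>R v))) (at 0 within UNIV)"
    proof (rule leibniz_rule_vector_derivative[where fx="\<lambda>s \<tau>. Duv ((x + s *\<^sub>R u) + \<tau> *\<^sub>R v)"])
      fix s \<tau> :: real
      show "((\<lambda>s. Dv (x + s *\<^sub>R u + \<tau> *\<^sub>R v)) has_vector_derivative Duv (x + s *\<^sub>R u + \<tau> *\<^sub>R v)) (at s within UNIV)"
        using smooth_line_derivative[OF sm(2), of "x + \<tau> *\<^sub>R v" u s UNIV]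
        unfolding Duv_def by (simp add: add_ac)
      show "(\<lambda>\<tau>. Dv (x + s *\<^sub>R u + \<tau> *\<^sub>R v)) integrable_on cbox 0 t"
        using ftc[of s] by (auto simp: integrable_on_def cbox_interval)
    next
      show "continuous_on (UNIV \<times> cbox 0 t) (\<lambda>(s, \<tau>). Duv (x + s *\<^sub>R u + \<tau> *\<^sub>R v))"
        unfolding case_prod_beta
        by (rule continuous_on_compose2[OF smooth_imp_continuous[OF smuv, of UNIV]])
           (auto intro!: continuous_intros)
    qed auto
    have "integral (cbox 0 t) (\<lambda>\<tau>. Dv ((x + s *\<^sub>R u) + \<tau> *\<^sub>R v)) = g ((x + t *\<^sub>R v) + s *\<^sub>R u) - g (x + s *\<^sub>R u)" for s
      using integral_unique[OF ftc[of s]] by (simp add: cbox_interval add_ac)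
    with lz have "((\<lambda>s. g ((x + t *\<^sub>R v) + s *\<^sub>R u) - g (x + s *\<^sub>R u)) has_vector_derivative
        integral {0..t} (\<lambda>\<tau>. Duv (x + \<tau> *\<^sub>R v))) (at 0)"
      by (simp add: cbox_interval)
    moreover have "((\<lambda>s. g ((x + t *\<^sub>R v) + s *\<^sub>R u) - g (x + s *\<^sub>R u)) has_vector_derivative
        Du ((x + t *\<^sub>R v) + 0 *\<^sub>R u) - Du (x + 0 *\<^sub>R u)) (at 0)"
      unfolding Du_def by (intro has_vector_derivative_diff smooth_line_derivative g)
    ultimately show ?thesis by (simp add: vector_derivative_unique_at)
  qed
  have c: "continuous_on {0..1} (\<lambda>\<tau>. Duv (x + \<tau> *\<^sub>R v))"
    by (rule continuous_on_compose2[OF smooth_imp_continuous[OF smuv, of UNIV]])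
       (auto intro!: continuous_intros)
  have "((\<lambda>t. integral {0..t} (\<lambda>\<tau>. Duv (x + \<tau> *\<^sub>R v))) has_vector_derivative Duv x) (at 0 within {0..1})"
    using integral_has_vector_derivative[OF c, of 0] by simp
  then have "((\<lambda>t. Du (x + t *\<^sub>R v) - Du x) has_vector_derivative Duv x) (at 0 within {0..1})"
    by (intro has_vector_derivative_transform[OF _ key]) auto
  moreover have "((\<lambda>t. Du (x + t *\<^sub>R v) - Du x) has_vector_derivative frechet_derivative Du (at (x + 0 *\<^sub>R v)) v - 0) (at 0 within {0..1})"
    by (intro has_vector_derivative_diff smooth_line_derivative sm) auto
  ultimately have "Duv x = frechet_derivative Du (at x) v"
    by (intro vector_derivative_unique_within_closed_interval[of 0 1 0]) auto
  then show ?thesis unfolding Duv_def Du_def Dv_def by simp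
qed

section \<open>Smoothness of the word-basis functions\<close>

lemma with_angles_eq: "with_angles \<iota> x \<theta> = with_angles \<iota> x 0 + angle_vec \<iota> \<theta>"
  by (auto simp: with_angles_def angle_vec_def vec_eq_iff)

lemma bounded_linear_with_angles: "bounded_linear (\<lambda>x. with_angles \<iota> x 0)"
  by (subst linear_conv_bounded_linear[symmetric])
     (auto simp: with_angles_def vec_eq_iff intro!: linearI)

lemma bounded_linear_angle_vec: "bounded_linear (angle_vec \<iota> :: real^'d::finite \<Rightarrow> real^'n::finite)"
  by (subst linear_conv_bounded_linear[symmetric])
     (auto simp: angle_vec_def vec_eq_iff intro!: linearI)

lemma bounded_linear_cvec: "bounded_linear cvec"
  by (subst linear_conv_bounded_linear[symmetric])
     (auto simp: cvec_def vec_eq_iff scaleR_conv_of_real[symmetric] intro!: linearI)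

lemma bounded_linear_smult: "bounded_linear (\<lambda>v::complex^'n::finite. c *s v)"
  by (rule bounded_bilinear.bounded_linear_right[OF bounded_bilinear_smult])

text \<open>
  Differentiation under the integral sign. The point \<open>with_angles \<iota> x \<theta>\<close> depends on \<open>x\<close> through a
  linear map (it forgets the angles of \<open>x\<close>), so the derivative is again an average of the same
  kind, with a directional derivative of \<open>g\<close> in place of \<open>g\<close>.
\<close>

lemma angle_average_has_derivative:
  fixes \<iota> :: "'d::finite \<Rightarrow> 'n::finite" and g :: "real^'n \<Rightarrow> real^'n" and e :: "real^'d \<Rightarrow> complex"
    and a b :: "real^'d"
  assumes g: "smooth g" and e: "continuous_on UNIV e"
  defines "G \<equiv> \<lambda>x. integral (cbox a b) (\<lambda>\<theta>. e \<theta> *s cvec (g (with_angles \<iota> x \<theta>)))"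
  shows "(G has_derivative (\<lambda>v. integral (cbox a b) (\<lambda>\<theta>. e \<theta> *s cvec
            (frechet_derivative g (at (with_angles \<iota> x \<theta>)) (with_angles \<iota> v 0))))) (at x)"
proof -
  \<comment> \<open>The derivative as an operator-valued integrand, the form that the Leibniz rule needs.\<close>
  define fx where "fx = (\<lambda>x \<theta>. Blinfun (\<lambda>v. e \<theta> *s cvec
            (frechet_derivative g (at (with_angles \<iota> x \<theta>)) (with_angles \<iota> v 0))))"
  have bl: "bounded_linear (\<lambda>v. e \<theta> *s cvec (frechet_derivative g (at (with_angles \<iota> x \<theta>)) (with_angles \<iota> v 0)))" for x \<theta>
    by (intro bounded_linear_compose[OF bounded_linear_smult] bounded_linear_compose[OF bounded_linear_cvec]
       bounded_linear_compose[OF _ bounded_linear_with_angles]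
       has_derivative_bounded_linear[OF smooth_imp_has_derivative[OF g]])
  have ap: "blinfun_apply (fx x \<theta>) = (\<lambda>v. e \<theta> *s cvec (frechet_derivative g (at (with_angles \<iota> x \<theta>)) (with_angles \<iota> v 0)))" for x \<theta>
    unfolding fx_def by (rule bounded_linear_Blinfun_apply[OF bl])
  have contw: "continuous_on S (\<lambda>p. with_angles \<iota> (fst p) (snd p))" for S
    by (subst with_angles_eq)
       (intro continuous_intros bounded_linear.continuous_on[OF bounded_linear_with_angles]
          bounded_linear.continuous_on[OF bounded_linear_angle_vec])
  have conte: "continuous_on S e" for S using e continuous_on_subset by blast
  have conta: "continuous_on (UNIV \<times> cbox a b) (\<lambda>p. e (snd p) *s cvec (q (with_angles \<iota> (fst p) (snd p))))"
    if q: "continuous_on UNIV q" for q :: "real^'n \<Rightarrow> real^'n"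
    by (intro bounded_bilinear.continuous_on[OF bounded_bilinear_smult]
        bounded_linear.continuous_on[OF bounded_linear_cvec]
        continuous_on_compose2[OF q contw] continuous_on_compose2[OF e continuous_on_snd[OF continuous_on_id]]) auto
  have "(G has_derivative integral (cbox a b) (fx x)) (at x within UNIV)"
    unfolding G_def
  proof (rule leibniz_rule)
    fix y and \<theta> :: "real^'d"
    have w: "((\<lambda>y. with_angles \<iota> y \<theta>) has_derivative (\<lambda>v. with_angles \<iota> v 0)) (at y within UNIV)"
      by (subst with_angles_eq) (auto intro!: derivative_eq_intros bounded_linear_imp_has_derivative bounded_linear_with_angles)
    show "((\<lambda>y. e \<theta> *s cvec (g (with_angles \<iota> y \<theta>))) has_derivative blinfun_apply (fx y \<theta>)) (at y within UNIV)"
      unfolding ap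
      by (intro bounded_linear.has_derivative[OF bounded_linear_smult] bounded_linear.has_derivative[OF bounded_linear_cvec]
          has_derivative_compose[OF w smooth_imp_has_derivative[OF g]])
  next
    fix y :: "real^'n"
    have "continuous_on (cbox a b) (\<lambda>\<theta>. (y,\<theta>))" by (intro continuous_intros)
    from continuous_on_compose2[OF conta[OF smooth_imp_continuous[OF g]] this]
    show "(\<lambda>\<theta>. e \<theta> *s cvec (g (with_angles \<iota> y \<theta>))) integrable_on cbox a b"
      by (intro integrable_continuous) auto
  next
    show "continuous_on (UNIV \<times> cbox a b) (\<lambda>(x, t). fx x t)"
      unfolding case_prod_beta
      by (intro continuous_on_blinfun_componentwise)
         (simp only: ap, intro conta smooth_imp_continuous smooth_directional g)
  qed auto
  moreover have ev: "blinfun_apply (integral (cbox a b) (fx x)) v =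
     integral (cbox a b) (\<lambda>\<theta>. e \<theta> *s cvec (frechet_derivative g (at (with_angles \<iota> x \<theta>)) (with_angles \<iota> v 0)))" for v
  proof -
    have "continuous_on (cbox a b) (\<lambda>\<theta>. (x,\<theta>))" by (intro continuous_intros)
    from continuous_on_compose2[OF conta[OF smooth_imp_continuous[OF smooth_directional[OF g]]] this]
    have "continuous_on (cbox a b) (fx x)"
      by (intro continuous_on_blinfun_componentwise) (auto simp: ap)
    then have "fx x integrable_on cbox a b" by (rule integrable_continuous)
    from blinfun_apply_integral[OF this] show ?thesis by (simp add: ap)
  qed
  ultimately show ?thesis unfolding fun_eq_iff[THEN iffD2, OF allI, OF ev] by simp
qed

lemma smooth_angle_average:
  fixes \<iota> :: "'d::finite \<Rightarrow> 'n::finite" and e :: "real^'d \<Rightarrow> complex"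
  assumes g: "smooth g" and e: "continuous_on UNIV e"
  shows "smooth (\<lambda>x. integral (cbox a b) (\<lambda>\<theta>. e \<theta> *s cvec (g (with_angles \<iota> x \<theta>) :: real^'n)))"
proof (rule smooth_coinduct[where P="\<lambda>G. \<exists>g. smooth g \<and> 
    G = (\<lambda>x. integral (cbox a b) (\<lambda>\<theta>. e \<theta> *s cvec (g (with_angles \<iota> x \<theta>) :: real^'n)))"])
  fix G :: "real^'n \<Rightarrow> complex^'n"
  assume "\<exists>g. smooth g \<and> G = (\<lambda>x. integral (cbox a b) (\<lambda>\<theta>. e \<theta> *s cvec (g (with_angles \<iota> x \<theta>) :: real^'n)))"
  then obtain g where g: "smooth g"
    and G: "G = (\<lambda>x. integral (cbox a b) (\<lambda>\<theta>. e \<theta> *s cvec (g (with_angles \<iota> x \<theta>) :: real^'n)))" by blast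
  note d = angle_average_has_derivative[OF g e, of a b \<iota>, folded G]
  have f: "frechet_derivative G (at x) v = integral (cbox a b) (\<lambda>\<theta>. e \<theta> *s cvec
            (frechet_derivative g (at (with_angles \<iota> x \<theta>)) (with_angles \<iota> v 0)))" for x v
    by (simp only: frechet_derivative_at[OF d, symmetric])
  show "(\<forall>x. G differentiable at x) \<and> (\<forall>v. \<exists>g. smooth g \<and> (\<lambda>x. frechet_derivative G (at x) v) =
      (\<lambda>x. integral (cbox a b) (\<lambda>\<theta>. e \<theta> *s cvec (g (with_angles \<iota> x \<theta>) :: real^'n))))"
    unfolding f
  proof (intro conjI allI)
    show "G differentiable at x" for x using d by (rule differentiableI)
    show "\<exists>g'. smooth g' \<and> (\<lambda>x. integral (cbox a b) (\<lambda>\<theta>. e \<theta> *s cvec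
            (frechet_derivative g (at (with_angles \<iota> x \<theta>)) (with_angles \<iota> v 0)))) =
      (\<lambda>x. integral (cbox a b) (\<lambda>\<theta>. e \<theta> *s cvec (g' (with_angles \<iota> x \<theta>))))" for v
      using smooth_directional[OF g] by (intro exI[of _ "\<lambda>x. frechet_derivative g (at x) (with_angles \<iota> v 0)"]) simp
  qed
qed (use g in blast)

lemma smooth_exp_linear:
  assumes L: "bounded_linear L"
  shows "smooth (\<lambda>x. exp (\<i> * complex_of_real (L x)))"
proof (rule smooth_coinduct[where P="\<lambda>g. \<exists>c. g = (\<lambda>x. c * exp (\<i> * complex_of_real (L x)))"])
  show "\<exists>c. (\<lambda>x. exp (\<i> * complex_of_real (L x))) = (\<lambda>x. c * exp (\<i> * complex_of_real (L x)))"
    by (rule exI[of _ 1]) simp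
  fix g :: "'a \<Rightarrow> complex" assume "\<exists>c. g = (\<lambda>x. c * exp (\<i> * complex_of_real (L x)))"
  then obtain c where g: "g = (\<lambda>x. c * exp (\<i> * complex_of_real (L x)))" by blast
  have 1: "((\<lambda>x. \<i> * complex_of_real (L x)) has_derivative (\<lambda>v. \<i> * complex_of_real (L v))) (at x)" for x
    by (intro bounded_linear_imp_has_derivative bounded_linear_compose[OF bounded_linear_mult_right]
         bounded_linear_compose[OF bounded_linear_of_real L])
  have d: "(g has_derivative (\<lambda>v. (c * (\<i> * complex_of_real (L v))) * exp (\<i> * complex_of_real (L x)))) (at x)" for x
    unfolding g
    by (rule has_derivative_eq_rhs[OF has_derivative_mult_right[OF has_derivative_compose[OF 1 DERIV_exp[unfolded has_field_derivative_def]]]])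
       (simp add: fun_eq_iff)
  have f: "frechet_derivative g (at x) v = (c * (\<i> * complex_of_real (L v))) * exp (\<i> * complex_of_real (L x))" for x v
    by (simp only: frechet_derivative_at[OF d, symmetric])
  show "(\<forall>x. g differentiable at x) \<and> (\<forall>v. \<exists>c. (\<lambda>x. frechet_derivative g (at x) v) = (\<lambda>x. c * exp (\<i> * complex_of_real (L x))))"
    unfolding f
  proof (intro conjI allI)
    show "g differentiable at x" for x using d by (rule differentiableI)
  qed (rule exI, rule refl)
qed

lemma smooth_letter_fun:
  fixes \<iota> :: "'d::finite \<Rightarrow> 'n::finite"
  assumes "smooth f" shows "smooth (letter_fun \<iota> f k)"
proof -
  have "bounded_linear (angles \<iota> :: real^'n \<Rightarrow> real^'d)"
    by (subst linear_conv_bounded_linear[symmetric]) (auto simp: angles_def vec_eq_iff intro!: linearI)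
  then have 1: "bounded_linear (\<lambda>x. freq k \<bullet> angles \<iota> x)"
    by (rule bounded_linear_compose[OF bounded_linear_inner_right])
  have 2: "continuous_on UNIV (\<lambda>\<theta>. exp (- \<i> * complex_of_real (freq k \<bullet> \<theta>)))"
    by (intro continuous_intros)
  have 3: "smooth (fourier_coeff \<iota> f k)"
    unfolding fourier_coeff_def[abs_def]
    by (rule smooth_bilinear[OF bounded_bilinear_scaleR smooth_const smooth_angle_average[OF assms 2]])
  show ?thesis unfolding letter_fun_def[abs_def]
    by (rule smooth_bilinear[OF bounded_bilinear_smult smooth_exp_linear[OF 1] 3])
qed

lemma smooth_partial_deriv: "smooth g \<Longrightarrow> smooth (partial_deriv i g)"
  unfolding partial_deriv_def[abs_def] by (rule smooth_directional)

lemma jacobian_mat_mult: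
  "jacobian_mat g x *v v = (\<Sum>i\<in>UNIV. (v $ i) *s partial_deriv i g x)"
  by (simp add: jacobian_mat_def matrix_vector_mult_def vec_eq_iff mult.commute)

lemma smooth_nth_smult: "smooth h \<Longrightarrow> smooth g \<Longrightarrow> smooth (\<lambda>x. (h x $ i) *s (g x))"
  for h :: "_ \<Rightarrow> complex^'m::finite" and g :: "_ \<Rightarrow> complex^'n::finite"
  by (rule smooth_bilinear[OF bounded_bilinear_nth_smult])

lemma smooth_word_fun: "smooth f \<Longrightarrow> smooth (word_fun \<iota> f w)"
proof (induction w rule: induct_list012)
  case 1
  then show ?case using smooth_bounded_linear[OF bounded_linear_cvec] by (simp add: eta_contract_eq)
next
  case (2 x)
  then show ?case using smooth_letter_fun by (simp add: eta_contract_eq)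
next
  case (3 k l w)
  have "word_fun \<iota> f (k # l # w) = (\<lambda>x. \<Sum>i\<in>UNIV. (letter_fun \<iota> f k x $ i) *s partial_deriv i (word_fun \<iota> f (l # w)) x)"
    by (rule ext) (simp add: jacobian_mat_mult)
  then show ?case
    using 3 by (simp only:) (intro smooth_sum smooth_nth_smult smooth_letter_fun smooth_partial_deriv; blast)
qed

section \<open>Rotation of the word-basis functions\<close>

text \<open>
  A function that a translation multiplies by a constant has partial derivatives with the same
  property. This carries the phase of a letter to all word-basis functions.
\<close>

lemma partial_deriv_translate:
  assumes g: "\<And>x. g (x + r) = c *s g x"
    and d: "\<And>x. g differentiable (at x)"
  shows "partial_deriv i g (x + r) = c *s partial_deriv i g x"
proof -
  have "((\<lambda>x. x + r) has_derivative (\<lambda>v. v)) (at x)" by (auto intro!: derivative_eq_intros)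
  from has_derivative_compose[OF this, of g "frechet_derivative g (at (x + r))"]
  have "((\<lambda>x. c *s g x) has_derivative frechet_derivative g (at (x + r))) (at x)"
    using d frechet_derivative_works g by auto
  moreover have "((\<lambda>x. c *s g x) has_derivative (\<lambda>v. c *s frechet_derivative g (at x) v)) (at x)"
    using d frechet_derivative_works by (intro bounded_linear.has_derivative[OF bounded_linear_smult]) auto
  ultimately show ?thesis unfolding partial_deriv_def by (metis has_derivative_unique)
qed

lemma letter_fun_rotate:
  assumes "inj \<iota>"
  shows "letter_fun \<iota> f k (x + angle_vec \<iota> v) = exp (\<i> * complex_of_real (freq k \<bullet> v)) *s letter_fun \<iota> f k x"
proof -
  have 1: "angles \<iota> (x + angle_vec \<iota> v) = angles \<iota> x + v"
    using assms by (simp add: angles_def angle_vec_def vec_eq_iff)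
  have "with_angles \<iota> (x + angle_vec \<iota> v) \<theta> = with_angles \<iota> x \<theta>" for \<theta>
    by (auto simp: with_angles_def angle_vec_def vec_eq_iff)
  then have 2: "fourier_coeff \<iota> f k (x + angle_vec \<iota> v) = fourier_coeff \<iota> f k x"
    by (simp add: fourier_coeff_def)
  show ?thesis
    unfolding letter_fun_def 1 2 inner_add_right of_real_add distrib_left exp_add
    by (simp add: vector_smult_assoc mult.commute)
qed

text \<open>
  The Fourier coefficients ignore the angles, so a rotation by \<open>v\<close> multiplies \<open>f\<^sub>k\<close> by
  \<open>exp (i k \<cdot> v)\<close>. Each letter of a word contributes its own phase.
\<close>

lemma word_fun_rotate:
  assumes "inj \<iota>" "smooth f" "w \<noteq> []"
  shows "word_fun \<iota> f w (x + angle_vec \<iota> v) = exp (\<i> * complex_of_real (sum_list (map freq w) \<bullet> v)) *s word_fun \<iota> f w x"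
  using assms(3)
proof (induction w arbitrary: x rule: induct_list012)
  case (2 k)
  then show ?case by (simp add: letter_fun_rotate[OF assms(1)])
next
  case (3 k l w)
  have "partial_deriv i (word_fun \<iota> f (l # w)) (x + angle_vec \<iota> v) =
     exp (\<i> * complex_of_real (sum_list (map freq (l # w)) \<bullet> v)) *s partial_deriv i (word_fun \<iota> f (l # w)) x" for i
    by (rule partial_deriv_translate) (use 3 smooth_imp_differentiable[OF smooth_word_fun[OF assms(2)]] in auto)
  then have "word_fun \<iota> f (k # l # w) (x + angle_vec \<iota> v) =
      (\<Sum>i\<in>UNIV. (exp (\<i> * complex_of_real (freq k \<bullet> v)) * exp (\<i> * complex_of_real (sum_list (map freq (l # w)) \<bullet> v))) *s
        ((letter_fun \<iota> f k x $ i) *s partial_deriv i (word_fun \<iota> f (l # w)) x))"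
    by (simp only: word_fun.simps jacobian_mat_mult letter_fun_rotate[OF assms(1)] vector_smult_assoc
        vector_smult_component mult.commute mult.left_commute)
  also have "\<dots> = (exp (\<i> * complex_of_real (freq k \<bullet> v)) * exp (\<i> * complex_of_real (sum_list (map freq (l # w)) \<bullet> v))) *s
      word_fun \<iota> f (k # l # w) x"
    by (simp only: word_fun.simps jacobian_mat_mult vec.scale_sum_right)
  also have "exp (\<i> * complex_of_real (freq k \<bullet> v)) * exp (\<i> * complex_of_real (sum_list (map freq (l # w)) \<bullet> v)) =
      exp (\<i> * complex_of_real (sum_list (map freq (k # l # w)) \<bullet> v))"
    by (simp only: list.map sum_list.Cons inner_add_left[of "freq k"] of_real_add distrib_left exp_add)
  finally show ?case .
qed simp

section \<open>Sums over submultisets\<close>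

text \<open>
  Identities between formal series are proved below by letting both sides depend on a real
  parameter and comparing derivatives.
\<close>

lemma eq_if_same_vector_derivative:
  fixes X Y :: "real \<Rightarrow> 'a::real_normed_vector"
  assumes X: "\<And>s. (X has_vector_derivative D s) (at s)"
    and Y: "\<And>s. (Y has_vector_derivative D s) (at s)"
    and 0: "X 0 = Y 0"
  shows "X t = Y t"
proof -
  have "((\<lambda>s. X s - Y s) has_vector_derivative 0) (at s within UNIV)" for s
    using has_vector_derivative_diff[OF X Y, of s] by simp
  then obtain c where "\<And>s. X s - Y s = c"
    using has_vector_derivative_zero_constant[of UNIV "\<lambda>s. X s - Y s"] by auto
  then show ?thesis using 0 by (metis eq_iff_diff_eq_0)
qed

lemma add_subset_eq_multiset: "N \<subseteq># M \<Longrightarrow> K \<subseteq># M - N \<longleftrightarrow> N + K \<subseteq># M"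
  by (simp add: add.commute subset_eq_diff_conv[symmetric] subset_mset.le_diff_conv2)

lemma sum_submultisets_swap:
  "(\<Sum>N | N \<subseteq># M \<and> P N. \<Sum>K | K \<subseteq># M - N \<and> Q K. F N K) =
   (\<Sum>K | K \<subseteq># M \<and> Q K. \<Sum>N | N \<subseteq># M - K \<and> P N. F N K)"
proof -
  have fin: "finite {N. N \<subseteq># M \<and> R N}" for R
    by (rule finite_subset[OF _ finite_submultisets[of M]]) auto
  have "{K. K \<subseteq># M - N \<and> Q K} = {K \<in> {K. K \<subseteq># M \<and> Q K}. N + K \<subseteq># M}" if "N \<subseteq># M" for N
    using add_subset_eq_multiset[OF that] by (auto intro: subset_mset.trans[OF _ diff_subset_eq_self])
  moreover have "{N. N \<subseteq># M - K \<and> P N} = {N \<in> {N. N \<subseteq># M \<and> P N}. N + K \<subseteq># M}" if "K \<subseteq># M" for K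
    using add_subset_eq_multiset[OF that] by (auto simp: add.commute intro: subset_mset.trans[OF _ diff_subset_eq_self])
  ultimately show ?thesis
    using sum.swap_restrict[OF fin[of P] fin[of Q], where g=F and R="\<lambda>N K. N + K \<subseteq># M"]
    by simp
qed

text \<open>
  Both sides run over the ways to write \<open>M\<close> as a sum of three multisets, the first of which
  satisfies \<open>P\<close>.
\<close>

lemma sum_submultisets_nested:
  "(\<Sum>K | K \<subseteq># M. \<Sum>N | N \<subseteq># K \<and> P N. F N (K - N)) =
   (\<Sum>N | N \<subseteq># M \<and> P N. \<Sum>K | K \<subseteq># M - N. F N K)"
proof -
  have fin: "finite {N. N \<subseteq># M \<and> R N}" for R
    by (rule finite_subset[OF _ finite_submultisets[of M]]) auto
  have "(\<Sum>K | K \<subseteq># M. \<Sum>N | N \<subseteq># K \<and> P N. F N (K - N)) =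
    (\<Sum>K\<in>{K. K \<subseteq># M}. \<Sum>N\<in>{N \<in> {N. N \<subseteq># M \<and> P N}. N \<subseteq># K}. F N (K - N))"
    by (rule sum.cong[OF refl], rule sum.cong) (auto intro: subset_mset.trans)
  also have "\<dots> = (\<Sum>N\<in>{N. N \<subseteq># M \<and> P N}. \<Sum>K\<in>{K \<in> {K. K \<subseteq># M}. N \<subseteq># K}. F N (K - N))"
    by (rule sum.swap_restrict[OF finite_submultisets fin])
  also have "\<dots> = (\<Sum>N | N \<subseteq># M \<and> P N. \<Sum>K | K \<subseteq># M - N. F N K)"
  proof (rule sum.cong[OF refl])
    fix N assume "N \<in> {N. N \<subseteq># M \<and> P N}"
    then have N: "N \<subseteq># M" by simp
    show "(\<Sum>K\<in>{K \<in> {K. K \<subseteq># M}. N \<subseteq># K}. F N (K - N)) = (\<Sum>K | K \<subseteq># M - N. F N K)"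
      by (rule sum.reindex_bij_witness[of _ "\<lambda>K. N + K" "\<lambda>K. K - N"])
         (use add_subset_eq_multiset[OF N] in auto)
  qed
  finally show ?thesis .
qed

section \<open>Partial derivatives\<close>

lemma partial_deriv_eqI: "(\<And>x. (g has_derivative g' x) (at x)) \<Longrightarrow> partial_deriv i g = (\<lambda>x. g' x (axis i 1))"
  unfolding partial_deriv_def[abs_def] by (metis frechet_derivative_at)

lemma partial_deriv_add:
  assumes "smooth g" "smooth h"
  shows "partial_deriv i (\<lambda>x. g x + h x) = (\<lambda>x. partial_deriv i g x + partial_deriv i h x)"
  unfolding partial_deriv_def[of i g] partial_deriv_def[of i h]
  by (rule partial_deriv_eqI[OF has_derivative_add]) (intro smooth_imp_has_derivative assms)+

lemma partial_deriv_smult: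
  assumes "smooth g"
  shows "partial_deriv i (\<lambda>x. c *s g x) = (\<lambda>x. c *s partial_deriv i g x)"
  unfolding partial_deriv_def[of i g]
  by (rule partial_deriv_eqI[OF bounded_linear.has_derivative[OF bounded_linear_smult]])
     (intro smooth_imp_has_derivative assms)

lemma partial_deriv_nth_smult:
  fixes g :: "real^'n::finite \<Rightarrow> complex^'m::finite" and h :: "real^'n \<Rightarrow> complex^'k::finite"
  assumes "smooth h" "smooth g"
  shows "partial_deriv j (\<lambda>x. (h x $ i) *s g x) =
    (\<lambda>x. (partial_deriv j h x $ i) *s g x + (h x $ i) *s partial_deriv j g x)"
  unfolding partial_deriv_def[of j g] partial_deriv_def[of j h]
  by (subst add.commute) (rule partial_deriv_eqI[OF bounded_bilinear.FDERIV[OF bounded_bilinear_nth_smult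
     smooth_imp_has_derivative[OF assms(1)] smooth_imp_has_derivative[OF assms(2)]]])

lemma partial_deriv_const: "partial_deriv i (\<lambda>x. c) = (\<lambda>x. 0)"
  by (rule partial_deriv_eqI) auto

lemma partial_deriv_cvec: "partial_deriv i cvec = (\<lambda>x. axis i 1)"
proof -
  have "partial_deriv i cvec = (\<lambda>x. cvec (axis i 1))"
    by (rule partial_deriv_eqI) (rule bounded_linear_imp_has_derivative[OF bounded_linear_cvec])
  then show ?thesis by (auto simp: cvec_def axis_def vec_eq_iff fun_eq_iff)
qed

lemma partial_deriv_commute: "smooth g \<Longrightarrow> partial_deriv i (partial_deriv j g) = partial_deriv j (partial_deriv i g)"
  unfolding partial_deriv_def[abs_def] by (rule ext) (rule frechet_derivative_symmetric)

section \<open>Formal Taylor expansion\<close>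

text \<open>
  The \<open>m\<close>-th order part of the formal Taylor expansion of \<open>g\<close> about \<open>p\<close> with increment \<open>c\<close>, without
  the factor \<open>1/m!\<close>, read off at the monomial \<open>M\<close>. Peeling off one increment at a time makes it
  accessible to induction on \<open>m\<close>.
\<close>

primrec taylor_term ::
  "nat \<Rightarrow> (real^'n::finite \<Rightarrow> complex^'n) \<Rightarrow> real^'n \<Rightarrow> ('a multiset \<Rightarrow> complex^'n) \<Rightarrow> 'a multiset \<Rightarrow> complex^'n" where
  "taylor_term 0 g p c M = (if M = {#} then g p else 0)"
| "taylor_term (Suc m) g p c M =
     (\<Sum>N | N \<subseteq># M \<and> N \<noteq> {#}. \<Sum>i\<in>UNIV. (c N $ i) *s taylor_term m (partial_deriv i g) p c (M - N))"

definition taylor ::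
  "(real^'n::finite \<Rightarrow> complex^'n) \<Rightarrow> real^'n \<Rightarrow> ('a multiset \<Rightarrow> complex^'n) \<Rightarrow> 'a multiset \<Rightarrow> complex^'n" where
  "taylor g p c M = (\<Sum>m\<le>size M. (1 / fact m) *s taylor_term m g p c M)"

lemma size_diff_less: "N \<subseteq># M \<Longrightarrow> N \<noteq> {#} \<Longrightarrow> size (M - N) < size M"
  by (metis diff_subset_eq_self mset_subset_size subset_mset.less_le subset_mset.diff_add add_cancel_right_right)

lemma taylor_term_eq_0: "size M < m \<Longrightarrow> taylor_term m g p c M = 0"
proof (induction m arbitrary: g M)
  case (Suc m)
  have "taylor_term m (partial_deriv i g) p c (M - N) = 0" if "N \<subseteq># M" "N \<noteq> {#}" for N i
    using size_diff_less[OF that] Suc.prems by (intro Suc.IH) simp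
  then show ?case by (simp add: sum.neutral)
qed simp

lemma taylor_atMost: 
  assumes "size M \<le> K"
  shows "taylor g p c M = (\<Sum>m\<le>K. (1 / fact m) *s taylor_term m g p c M)"
  unfolding taylor_def
  by (rule sum.mono_neutral_left) (use assms in \<open>auto simp: taylor_term_eq_0\<close>)

lemma taylor_empty [simp]: "taylor g p c {#} = g p"
  by (simp add: taylor_def)

text \<open>
  Only the increments at nonempty submultisets enter. This locality makes the differential equations
  for formal flows triangular in the size of the monomial.
\<close>

lemma taylor_term_cong:
  "(\<And>N. N \<subseteq># M \<Longrightarrow> N \<noteq> {#} \<Longrightarrow> c N = c' N) \<Longrightarrow> taylor_term m g p c M = taylor_term m g p c' M"
proof (induction m arbitrary: g M)
  case (Suc m)
  have "taylor_term m (partial_deriv i g) p c (M - N) = taylor_term m (partial_deriv i g) p c' (M - N)" for N i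
    by (rule Suc.IH, rule Suc.prems) (auto intro: subset_mset.trans[OF _ diff_subset_eq_self])
  then show ?case using Suc.prems by (auto intro!: sum.cong)
qed simp

lemma taylor_cong:
  "(\<And>N. N \<subseteq># M \<Longrightarrow> N \<noteq> {#} \<Longrightarrow> c N = c' N) \<Longrightarrow> taylor g p c M = taylor g p c' M"
  unfolding taylor_def by (rule sum.cong[OF refl]) (metis taylor_term_cong)

lemma taylor_term_add:
  "smooth g \<Longrightarrow> smooth h \<Longrightarrow> taylor_term m (\<lambda>x. g x + h x) p c M = taylor_term m g p c M + taylor_term m h p c M"
proof (induction m arbitrary: g h M)
  case (Suc m)
  then show ?case
    by (simp add: partial_deriv_add smooth_partial_deriv vec.scale_right_distrib sum.distrib)
qed simp

lemma taylor_add: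
  "smooth g \<Longrightarrow> smooth h \<Longrightarrow> taylor (\<lambda>x. g x + h x) p c M = taylor g p c M + taylor h p c M"
  by (simp add: taylor_def taylor_term_add vec.scale_right_distrib sum.distrib)

lemma taylor_term_smult:
  "smooth g \<Longrightarrow> taylor_term m (\<lambda>x. a *s g x) p c M = a *s taylor_term m g p c M"
proof (induction m arbitrary: g M)
  case (Suc m)
  then show ?case
    by (simp add: partial_deriv_smult smooth_partial_deriv vec.scale_sum_right vector_smult_assoc mult.commute)
qed simp

lemma smooth_smult: "smooth g \<Longrightarrow> smooth (\<lambda>x. a *s (g x :: complex^'m::finite))"
  by (rule smooth_bilinear[OF bounded_bilinear_smult smooth_const])

lemma taylor_smult: "smooth g \<Longrightarrow> taylor (\<lambda>x. a *s g x) p c M = a *s taylor g p c M"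
  by (simp add: taylor_def taylor_term_smult vec.scale_sum_right vector_smult_assoc mult.commute)

lemma taylor_term_const: "taylor_term m (\<lambda>x. v) p c M = (if m = 0 \<and> M = {#} then v else 0)"
proof (induction m arbitrary: v M)
  case (Suc m)
  then show ?case by (simp add: partial_deriv_const)
qed simp

lemma taylor_const: "taylor (\<lambda>x. v) p c M = (if M = {#} then v else 0)"
  by (simp add: taylor_def taylor_term_const sum.delta if_distrib[of "\<lambda>v. _ *s v"] cong: if_cong)

lemma taylor_sum:
  "finite J \<Longrightarrow> (\<And>j. j \<in> J \<Longrightarrow> smooth (g j)) \<Longrightarrow> taylor (\<lambda>x. \<Sum>j\<in>J. g j x) p c M = (\<Sum>j\<in>J. taylor (g j) p c M)"
  by (induction J rule: finite_induct) (simp_all add: taylor_const taylor_add smooth_sum)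

lemma taylor_cvec: 
  assumes "M \<noteq> {#}" shows "taylor cvec p c M = c M"
proof -
  have "taylor_term (Suc m) cvec p c M = (if m = 0 then c M else 0)" for m
  proof -
    have "taylor_term (Suc m) cvec p c M = (\<Sum>N | N \<subseteq># M \<and> N \<noteq> {#}. if m = 0 \<and> N = M then c M else 0)"
      unfolding taylor_term.simps partial_deriv_cvec taylor_term_const
    proof (rule sum.cong[OF refl])
      fix N assume "N \<in> {N. N \<subseteq># M \<and> N \<noteq> {#}}"
      then have "M - N = {#} \<longleftrightarrow> N = M" by (auto simp: Diff_eq_empty_iff_mset)
      moreover have "(\<Sum>i\<in>UNIV. (c M $ i) *s axis i (1::complex)) = c M"
        by (simp add: vec_eq_iff axis_def if_distrib cong: if_cong)
      ultimately show "(\<Sum>i\<in>UNIV. c N $ i *s (if m = 0 \<and> M - N = {#} then axis i 1 else 0)) =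
            (if m = 0 \<and> N = M then c M else 0)" by auto
    qed
    also have "\<dots> = (if m = 0 then c M else 0)"
    proof -
      have "finite {N. N \<subseteq># M \<and> N \<noteq> {#}}"
        by (rule finite_subset[OF _ finite_submultisets[of M]]) auto
      then show ?thesis using assms by (simp add: sum.delta)
    qed
    finally show ?thesis .
  qed
  moreover have "size M = Suc (size M - 1)" using assms by (metis Suc_pred' nonempty_has_size)
  then obtain k where "size M = Suc k" ..
  ultimately show ?thesis using assms
    by (simp add: taylor_def sum.atMost_Suc_shift sum.delta if_distrib[of "\<lambda>v. _ *s v"] del: sum.atMost_Suc taylor_term.simps(2) cong: if_cong)
qed

lemma taylor_zero: "taylor g p (\<lambda>N. 0) M = (if M = {#} then g p else 0)"
proof -
  have "taylor_term m g p (\<lambda>N. 0) M = (if m = 0 \<and> M = {#} then g p else 0)" for m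
    by (cases m) auto
  then show ?thesis by (simp add: taylor_def sum.delta if_distrib[of "\<lambda>v. _ *s v"] cong: if_cong)
qed

text \<open>
  The expansion about \<open>x + r\<close> involves the derivatives of \<open>g\<close> at \<open>x + r\<close>, and these are \<open>a\<close> times
  those at \<open>x\<close>.
\<close>

lemma taylor_term_translate:
  assumes "smooth g" "\<And>x. g (x + r) = a *s g x"
  shows "taylor_term m g (x + r) c M = a *s taylor_term m g x c M"
  using assms
proof (induction m arbitrary: g M)
  case (Suc m)
  have "taylor_term m (partial_deriv i g) (x + r) c (M - N) = a *s taylor_term m (partial_deriv i g) x c (M - N)" for i N
    using Suc.prems by (intro Suc.IH smooth_partial_deriv partial_deriv_translate smooth_imp_differentiable)
  then show ?case by (simp add: vec.scale_sum_right vector_smult_assoc mult.commute)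
qed simp

lemma taylor_translate:
  assumes "smooth g" "\<And>x. g (x + r) = a *s g x"
  shows "taylor g (x + r) c M = a *s taylor g x c M"
  by (simp add: taylor_def taylor_term_translate[OF assms] vec.scale_sum_right vector_smult_assoc mult.commute)


text \<open>
  Each of the \<open>m\<close> increments can be the one that is differentiated. In the recursive form the
  differentiated increment has to be moved past the one peeled off first, which exchanges two
  partial derivatives; here the symmetry of second derivatives enters.
\<close>

lemma taylor_term_has_vector_derivative:
  fixes g :: "real^'n::finite \<Rightarrow> complex^'n" and c :: "real \<Rightarrow> 'a multiset \<Rightarrow> complex^'n"
  assumes c: "\<And>N. N \<noteq> {#} \<Longrightarrow> ((\<lambda>t. c t N) has_vector_derivative c' N) (at t)"
  shows "smooth g \<Longrightarrow> ((\<lambda>t. taylor_term m g p (c t) M) has_vector_derivative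
    of_nat m *s (\<Sum>N | N \<subseteq># M \<and> N \<noteq> {#}. \<Sum>i\<in>UNIV. (c' N $ i) *s taylor_term (m - 1) (partial_deriv i g) p (c t) (M - N))) (at t)"
proof (induction m arbitrary: g M)
  case 0
  then show ?case by simp
next
  case (Suc m)
  let ?S = "\<lambda>M. {N. N \<subseteq># M \<and> N \<noteq> {#}}"
  let ?D = "\<lambda>m g M. \<Sum>N\<in>?S M. \<Sum>i\<in>UNIV. (c' N $ i) *s taylor_term m (partial_deriv i g) p (c t) (M - N)"
  have sg: "smooth (partial_deriv i g)" for i by (rule smooth_partial_deriv[OF Suc.prems])
  have "((\<lambda>t. taylor_term (Suc m) g p (c t) M) has_vector_derivative
     (\<Sum>N\<in>?S M. \<Sum>i\<in>UNIV. (c t N $ i) *s (of_nat m *s ?D (m - 1) (partial_deriv i g) (M - N)) +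
        (c' N $ i) *s taylor_term m (partial_deriv i g) p (c t) (M - N))) (at t)"
    unfolding taylor_term.simps
    by (intro has_vector_derivative_sum bounded_bilinear.has_vector_derivative[OF bounded_bilinear_nth_smult] c Suc.IH sg) auto
  moreover have "(\<Sum>N\<in>?S M. \<Sum>i\<in>UNIV. (c t N $ i) *s (of_nat m *s ?D (m - 1) (partial_deriv i g) (M - N))) = of_nat m *s ?D m g M"
  proof (cases m)
    case (Suc k)
    have "(\<Sum>N\<in>?S M. \<Sum>i\<in>UNIV. (c t N $ i) *s ?D k (partial_deriv i g) (M - N)) =
      (\<Sum>N\<in>?S M. \<Sum>K\<in>?S (M - N). \<Sum>i\<in>UNIV. \<Sum>j\<in>UNIV. (c t N $ i * c' K $ j) *s
          taylor_term k (partial_deriv j (partial_deriv i g)) p (c t) (M - N - K))"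
      by (rule sum.cong[OF refl], subst sum.swap) (simp add: vec.scale_sum_right vector_smult_assoc)
    also have "\<dots> = (\<Sum>K\<in>?S M. \<Sum>N\<in>?S (M - K). \<Sum>i\<in>UNIV. \<Sum>j\<in>UNIV. (c t N $ i * c' K $ j) *s
          taylor_term k (partial_deriv j (partial_deriv i g)) p (c t) (M - N - K))"
      by (rule sum_submultisets_swap)
    also have "\<dots> = (\<Sum>K\<in>?S M. \<Sum>j\<in>UNIV. \<Sum>N\<in>?S (M - K). \<Sum>i\<in>UNIV. (c t N $ i * c' K $ j) *s
          taylor_term k (partial_deriv j (partial_deriv i g)) p (c t) (M - N - K))"
      by (rule sum.cong[OF refl], subst (2) sum.swap, rule sum.cong[OF refl], rule sum.swap)
    also have "\<dots> = ?D m g M"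
      unfolding Suc taylor_term.simps vec.scale_sum_right vector_smult_assoc
      by (intro sum.cong refl) (simp add: mult.commute add.commute partial_deriv_commute[OF Suc.prems])
    finally have "(\<Sum>N\<in>?S M. \<Sum>i\<in>UNIV. (c t N $ i) *s ?D k (partial_deriv i g) (M - N)) = ?D m g M" .
    moreover have "(\<Sum>N\<in>?S M. \<Sum>i\<in>UNIV. (c t N $ i) *s (of_nat m *s X N i)) =
        of_nat m *s (\<Sum>N\<in>?S M. \<Sum>i\<in>UNIV. (c t N $ i) *s X N i)" for X :: "'a multiset \<Rightarrow> 'n \<Rightarrow> complex^'n"
      by (simp add: vec.scale_sum_right vector_smult_assoc mult.commute)
    ultimately show ?thesis by (simp only: Suc diff_Suc_1)
  qed simp
  moreover have "of_nat m *s ?D m g M + ?D m g M = of_nat (Suc m) *s ?D m g M"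
    by (simp add: vec.scale_left_distrib)
  ultimately show ?case by (simp only: sum.distrib diff_Suc_1)
qed

text \<open>
  The chain rule: the factor \<open>m\<close> from the \<open>m\<close>-th order term cancels against \<open>1/m!\<close> and shifts the
  order by one, so a full expansion, now of the partial derivatives, appears again.
\<close>

lemma taylor_has_vector_derivative:
  fixes g :: "real^'n::finite \<Rightarrow> complex^'n"
  assumes c: "\<And>N. N \<noteq> {#} \<Longrightarrow> ((\<lambda>t. c t N) has_vector_derivative c' N) (at t)"
    and g: "smooth g"
  shows "((\<lambda>t. taylor g p (c t) M) has_vector_derivative
    (\<Sum>N | N \<subseteq># M \<and> N \<noteq> {#}. \<Sum>i\<in>UNIV. (c' N $ i) *s taylor (partial_deriv i g) p (c t) (M - N))) (at t)"
proof (cases "M = {#}")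
  case True
  then show ?thesis by simp
next
  case False
  then obtain K where K: "size M = Suc K" by (metis Suc_pred' nonempty_has_size)
  let ?S = "{N. N \<subseteq># M \<and> N \<noteq> {#}}"
  let ?D = "\<lambda>m. \<Sum>N\<in>?S. \<Sum>i\<in>UNIV. (c' N $ i) *s taylor_term m (partial_deriv i g) p (c t) (M - N)"
  have "((\<lambda>t. taylor g p (c t) M) has_vector_derivative
     (\<Sum>m\<le>size M. (1 / fact m) *s (of_nat m *s ?D (m - 1)))) (at t)"
    unfolding taylor_def
    by (intro has_vector_derivative_sum bounded_linear.has_vector_derivative[OF bounded_linear_smult]
       taylor_term_has_vector_derivative c g)
  moreover have "(\<Sum>m\<le>size M. (1 / fact m) *s (of_nat m *s ?D (m - 1))) = (\<Sum>m\<le>K. (1 / fact m) *s ?D m)"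
  proof -
    have "(1 / fact (Suc m)) *s (of_nat (Suc m) *s v) = (1 / fact m) *s v" for m and v :: "complex^'n"
      by (simp only: vector_smult_assoc fact_Suc) (simp add: field_simps del: of_nat_Suc)
    then show ?thesis unfolding K sum.atMost_Suc_shift by simp
  qed
  moreover have "\<dots> = (\<Sum>N\<in>?S. \<Sum>i\<in>UNIV. (c' N $ i) *s taylor (partial_deriv i g) p (c t) (M - N))"
  proof -
    have "taylor (partial_deriv i g) p (c t) (M - N) = (\<Sum>m\<le>K. (1 / fact m) *s taylor_term m (partial_deriv i g) p (c t) (M - N))"
      if "N \<in> ?S" for N i
      using that size_diff_less[of N M] K by (intro taylor_atMost) auto
    then have "(\<Sum>N\<in>?S. \<Sum>i\<in>UNIV. (c' N $ i) *s taylor (partial_deriv i g) p (c t) (M - N)) =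
      (\<Sum>N\<in>?S. \<Sum>i\<in>UNIV. \<Sum>m\<le>K. (1 / fact m) *s ((c' N $ i) *s taylor_term m (partial_deriv i g) p (c t) (M - N)))"
      by (simp add: vec.scale_sum_right vector_smult_assoc mult.commute)
    also have "\<dots> = (\<Sum>N\<in>?S. \<Sum>m\<le>K. \<Sum>i\<in>UNIV. (1 / fact m) *s ((c' N $ i) *s taylor_term m (partial_deriv i g) p (c t) (M - N)))"
      by (rule sum.cong[OF refl], rule sum.swap)
    also have "\<dots> = (\<Sum>m\<le>K. (1 / fact m) *s ?D m)"
      by (subst sum.swap) (simp only: vec.scale_sum_right)
    finally show ?thesis by simp
  qed
  ultimately show ?thesis by simp
qed

text \<open>
  Substitution is multiplicative. Replace the increment \<open>c\<close> by \<open>s c\<close>. By the chain rule the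
  derivatives of both sides with respect to \<open>s\<close> only involve expansions of products at smaller
  monomials, where the identity is known by induction; the Leibniz rule makes the derivatives equal.
  At \<open>s = 0\<close> both sides are constant terms, and \<open>s = 1\<close> is the claim. This avoids the
  combinatorics of distributing the increments over the two factors.
\<close>

lemma taylor_product:
  fixes g h :: "real^'n::finite \<Rightarrow> complex^'n"
  assumes "smooth h" "smooth g"
  shows "taylor (\<lambda>x. (h x $ i) *s g x) p c M = (\<Sum>N | N \<subseteq># M. (taylor h p c N $ i) *s taylor g p c (M - N))"
  using assms
proof (induction "size M" arbitrary: M g h c rule: less_induct)
  case less
  note h = less.prems(1) and g = less.prems(2)
  show ?case
  proof (cases "M = {#}")
    case True
    then show ?thesis by (simp add: Collect_conv_if)
  next
    case False
    let ?S = "\<lambda>M. {N. N \<subseteq># M \<and> N \<noteq> {#}}" and ?A = "\<lambda>M. {N. N \<subseteq># M}"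
    \<comment> \<open>The family that joins the constant term (\<open>s = 0\<close>) to the given increment (\<open>s = 1\<close>).\<close>
    define cs where "cs = (\<lambda>s N. s *\<^sub>R c N)"
    have cs: "((\<lambda>s. cs s N) has_vector_derivative c N) (at s)" for s N
      unfolding cs_def by (auto intro!: derivative_eq_intros)
    note T = taylor_has_vector_derivative[where c=cs and c'=c, OF cs]
    \<comment> \<open>The two halves of the common derivative: the derivative falls on \<open>h\<close> or on \<open>g\<close>.\<close>
    define D1 D2 where
      "D1 = (\<lambda>s. \<Sum>N\<in>?S M. \<Sum>K\<in>?A (M - N). \<Sum>j\<in>UNIV. (c N $ j) *s ((taylor (partial_deriv j h) p (cs s) K $ i) *s taylor g p (cs s) (M - N - K)))"
      and "D2 = (\<lambda>s. \<Sum>N\<in>?S M. \<Sum>K\<in>?A (M - N). \<Sum>j\<in>UNIV. (c N $ j) *s ((taylor h p (cs s) K $ i) *s taylor (partial_deriv j g) p (cs s) (M - N - K)))"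
    have X: "((\<lambda>s. taylor (\<lambda>x. (h x $ i) *s g x) p (cs s) M) has_vector_derivative D1 s + D2 s) (at s)" for s
    proof -
      have "taylor (partial_deriv j (\<lambda>x. (h x $ i) *s g x)) p (cs s) (M - N) =
         (\<Sum>K\<in>?A (M - N). (taylor (partial_deriv j h) p (cs s) K $ i) *s taylor g p (cs s) (M - N - K)) +
         (\<Sum>K\<in>?A (M - N). (taylor h p (cs s) K $ i) *s taylor (partial_deriv j g) p (cs s) (M - N - K))"
        if "N \<in> ?S M" for N j
      proof -
        have l: "size (M - N) < size M" using that size_diff_less by auto
        show ?thesis
          by (simp add: partial_deriv_nth_smult[OF h g] taylor_add smooth_nth_smult smooth_partial_deriv g h
            less.hyps[OF l])
      qed
      then have "(\<Sum>N\<in>?S M. \<Sum>j\<in>UNIV. (c N $ j) *s taylor (partial_deriv j (\<lambda>x. (h x $ i) *s g x)) p (cs s) (M - N)) = D1 s + D2 s"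
        unfolding D1_def D2_def sum.distrib[symmetric]
        by (intro sum.cong refl, subst sum.swap)
           (simp add: vec.scale_right_distrib sum.distrib vec.scale_sum_right)
      moreover have "((\<lambda>s. taylor (\<lambda>x. (h x $ i) *s g x) p (cs s) M) has_vector_derivative
          (\<Sum>N\<in>?S M. \<Sum>j\<in>UNIV. (c N $ j) *s taylor (partial_deriv j (\<lambda>x. (h x $ i) *s g x)) p (cs s) (M - N))) (at s)"
        by (rule T[OF smooth_nth_smult[OF h g]])
      ultimately show ?thesis by (simp only:)
    qed
    have Y: "((\<lambda>s. \<Sum>N\<in>?A M. (taylor h p (cs s) N $ i) *s taylor g p (cs s) (M - N)) has_vector_derivative D1 s + D2 s) (at s)" for s
    proof -
      have "((\<lambda>s. \<Sum>K\<in>?A M. (taylor h p (cs s) K $ i) *s taylor g p (cs s) (M - K)) has_vector_derivative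
        (\<Sum>K\<in>?A M. (taylor h p (cs s) K $ i) *s (\<Sum>N\<in>?S (M - K). \<Sum>j\<in>UNIV. (c N $ j) *s taylor (partial_deriv j g) p (cs s) (M - K - N)) +
          ((\<Sum>N\<in>?S K. \<Sum>j\<in>UNIV. (c N $ j) *s taylor (partial_deriv j h) p (cs s) (K - N)) $ i) *s taylor g p (cs s) (M - K))) (at s)"
        by (intro has_vector_derivative_sum bounded_bilinear.has_vector_derivative[OF bounded_bilinear_nth_smult]
            T g h)
      moreover have "(\<Sum>K\<in>?A M. (taylor h p (cs s) K $ i) *s (\<Sum>N\<in>?S (M - K). \<Sum>j\<in>UNIV. (c N $ j) *s taylor (partial_deriv j g) p (cs s) (M - K - N))) = D2 s"
        unfolding D2_def
        using sum_submultisets_swap[where P="\<lambda>N. N \<noteq> {#}" and Q="\<lambda>K. True" and M=M and F="\<lambda>N K. \<Sum>j\<in>UNIV. (c N $ j) *s ((taylor h p (cs s) K $ i) *s taylor (partial_deriv j g) p (cs s) (M - N - K))"]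
        by (simp add: vec.scale_sum_right vector_smult_assoc mult.commute add.commute)
      moreover have "(\<Sum>K\<in>?A M. ((\<Sum>N\<in>?S K. \<Sum>j\<in>UNIV. (c N $ j) *s taylor (partial_deriv j h) p (cs s) (K - N)) $ i) *s taylor g p (cs s) (M - K)) = D1 s"
      proof -
        have "((\<Sum>N\<in>?S K. \<Sum>j\<in>UNIV. (c N $ j) *s taylor (partial_deriv j h) p (cs s) (K - N)) $ i) *s taylor g p (cs s) (M - K) =
          (\<Sum>N\<in>?S K. \<Sum>j\<in>UNIV. (c N $ j) *s ((taylor (partial_deriv j h) p (cs s) (K - N) $ i) *s taylor g p (cs s) (M - N - (K - N))))" for K
        proof -
          have "M - N - (K - N) = M - K" if "N \<subseteq># K" for N
            using that by (metis diff_diff_add subset_mset.add_diff_inverse)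
          then show ?thesis by (simp add: vec.scale_sum_left vector_smult_assoc)
        qed
        then show ?thesis
          unfolding D1_def using sum_submultisets_nested[where P="\<lambda>N. N \<noteq> {#}" and M=M
            and F="\<lambda>N K. \<Sum>j\<in>UNIV. (c N $ j) *s ((taylor (partial_deriv j h) p (cs s) K $ i) *s taylor g p (cs s) (M - N - K))"] by simp
      qed
      ultimately show ?thesis by (simp add: sum.distrib add.commute)
    qed
    have "taylor (\<lambda>x. (h x $ i) *s g x) p (cs 0) M = (\<Sum>N\<in>?A M. (taylor h p (cs 0) N $ i) *s taylor g p (cs 0) (M - N))"
    proof -
      have "(taylor h p (cs 0) N $ i) *s taylor g p (cs 0) (M - N) = 0" for N
        using False by (cases "N = {#}") (simp_all add: cs_def taylor_zero)
      then have "(\<Sum>N\<in>?A M. (taylor h p (cs 0) N $ i) *s taylor g p (cs 0) (M - N)) = 0"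
        by (simp only: sum.neutral_const)
      then show ?thesis using False by (simp only:) (simp add: cs_def taylor_zero)
    qed
    from eq_if_same_vector_derivative[OF X Y this, of 1] show ?thesis by (simp add: cs_def)
  qed
qed

lemma sum_index_lists_Suc:
  "(\<Sum>is | length is = Suc m. F is) = (\<Sum>i\<in>(UNIV::'n::finite set). \<Sum>is | length is = m. F (is @ [i]))"
proof -
  have "(\<Sum>is | length is = Suc m. F is) = (\<Sum>(i, is)\<in>UNIV \<times> {is. length is = m}. F (is @ [i]))"
  proof (rule sum.reindex_bij_witness[of _ "\<lambda>(i, is). is @ [i]" "\<lambda>is. (last is, butlast is)"])
    fix js :: "'n list" assume "js \<in> {is. length is = Suc m}"
    then show "(last js, butlast js) \<in> UNIV \<times> {is. length is = m}"
      "(case (last js, butlast js) of (i, is) \<Rightarrow> is @ [i]) = js"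
      "(case (last js, butlast js) of (i, is) \<Rightarrow> F (is @ [i])) = F js"
      by (auto simp: append_butlast_last_id length_greater_0_conv[symmetric] simp del: length_greater_0_conv)
  qed auto
  then show ?thesis by (simp add: sum.cartesian_product)
qed

lemma sum_ordered_partitions_Suc:
  "(\<Sum>Ls | {#} \<notin> set Ls \<and> sum_list Ls = M \<and> length Ls = Suc m. F Ls) =
   (\<Sum>N | N \<subseteq># M \<and> N \<noteq> {#}. \<Sum>Ls | {#} \<notin> set Ls \<and> sum_list Ls = M - N \<and> length Ls = m. F (Ls @ [N]))"
proof -
  let ?P = "\<lambda>M m. {Ls. {#} \<notin> set Ls \<and> sum_list Ls = M \<and> length Ls = m}"
  have fin: "finite (?P M m)" for M m
    by (rule finite_subset[OF _ finite_ordered_partitions[of M]]) auto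
  have "(\<Sum>Ls\<in>?P M (Suc m). F Ls) =
     (\<Sum>(N, Ls)\<in>(SIGMA N:{N. N \<subseteq># M \<and> N \<noteq> {#}}. ?P (M - N) m). F (Ls @ [N]))"
  proof (rule sum.reindex_bij_witness[of _ "\<lambda>(N, Ls). Ls @ [N]" "\<lambda>Ls. (last Ls, butlast Ls)"])
    fix Ls assume "Ls \<in> ?P M (Suc m)"
    moreover from this obtain Ls' N where "Ls = Ls' @ [N]" by (cases Ls rule: rev_cases) auto
    ultimately show "(last Ls, butlast Ls) \<in> (SIGMA N:{N. N \<subseteq># M \<and> N \<noteq> {#}}. ?P (M - N) m)"
      "(case (last Ls, butlast Ls) of (N, Ls) \<Rightarrow> Ls @ [N]) = Ls"
      "(case (last Ls, butlast Ls) of (N, Ls) \<Rightarrow> F (Ls @ [N])) = F Ls"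
      by auto
  qed auto
  also have "\<dots> = (\<Sum>N | N \<subseteq># M \<and> N \<noteq> {#}. \<Sum>Ls\<in>?P (M - N) m. F (Ls @ [N]))"
    by (rule sum.Sigma[symmetric]) (auto intro: fin finite_subset[OF _ finite_submultisets[of M]])
  finally show ?thesis .
qed

text \<open>
  In \<open>foldr partial_deriv\<close> the last index acts first on \<open>g\<close>, so the recursion for
  \<open>taylor_term\<close> peels off the last entries of both lists.
\<close>

lemma taylor_term_eq_sum_lists:
  "taylor_term m g p c M = (\<Sum>Ls | {#} \<notin> set Ls \<and> sum_list Ls = M \<and> length Ls = m. \<Sum>is | length is = m.
     (\<Prod>j<m. c (Ls ! j) $ (is ! j)) *s foldr partial_deriv is g p)"
proof (induction m arbitrary: g M)
  case 0
  have "{Ls. {#} \<notin> set Ls \<and> sum_list Ls = M \<and> length Ls = 0} = (if M = {#} then {[]} else {})" by auto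
  then show ?case by simp
next
  case (Suc m)
  show ?case
    unfolding taylor_term.simps sum_ordered_partitions_Suc sum_index_lists_Suc Suc.IH
  proof (rule sum.cong[OF refl])
    fix N
    let ?P = "{Ls. {#} \<notin> set Ls \<and> sum_list Ls = M - N \<and> length Ls = m}"
    have "(c N $ i) *s (\<Sum>Ls\<in>?P. \<Sum>is | length is = m. (\<Prod>j<m. c (Ls ! j) $ (is ! j)) *s foldr partial_deriv is (partial_deriv i g) p)
      = (\<Sum>Ls\<in>?P. \<Sum>is | length is = m. (\<Prod>j<Suc m. c ((Ls @ [N]) ! j) $ ((is @ [i]) ! j)) *s foldr partial_deriv (is @ [i]) g p)" for i
      unfolding vec.scale_sum_right
      by (intro sum.cong refl) (simp add: nth_append vector_smult_assoc mult.commute)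
    then show "(\<Sum>i\<in>UNIV. (c N $ i) *s (\<Sum>Ls\<in>?P. \<Sum>is | length is = m. (\<Prod>j<m. c (Ls ! j) $ (is ! j)) *s foldr partial_deriv is (partial_deriv i g) p))
      = (\<Sum>Ls\<in>?P. \<Sum>i\<in>UNIV. \<Sum>is | length is = m. (\<Prod>j<Suc m. c ((Ls @ [N]) ! j) $ ((is @ [i]) ! j)) *s foldr partial_deriv (is @ [i]) g p)"
      by (simp only:) (rule sum.swap)
  qed
qed

lemma length_le_size_sum_list: "{#} \<notin> set Ls \<Longrightarrow> length Ls \<le> size (sum_list Ls)"
proof (induction Ls)
  case (Cons K Ls)
  then have "1 \<le> size K" by (simp add: Suc_le_eq nonempty_has_size)
  with Cons show ?case by simp
qed simp

text \<open>
  Links the sum over ordered partitions and index lists with the recursive form: group the ordered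
  partitions by their length, which is at most the size of the multiset.
\<close>

lemma taylor_coeff_eq_taylor: "taylor_coeff g G L x = taylor g (base_point G x) (\<lambda>N. G N x) L"
proof -
  let ?P = "{Ls. {#} \<notin> set Ls \<and> sum_list Ls = L}"
  let ?F = "\<lambda>Ls. \<Sum>is | length is = length Ls. ((\<Prod>j<length Ls. G (Ls ! j) x $ (is ! j)) / fact (length Ls)) *s
          foldr partial_deriv is g (base_point G x)"
  have "(\<Sum>m\<in>{..size L}. sum ?F {Ls \<in> ?P. length Ls = m}) = sum ?F ?P"
    by (rule sum.group) (use length_le_size_sum_list in \<open>auto simp: finite_ordered_partitions\<close>)
  moreover have "sum ?F {Ls \<in> ?P. length Ls = m} = (1 / fact m) *s taylor_term m g (base_point G x) (\<lambda>N. G N x) L" for m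
    unfolding taylor_term_eq_sum_lists vec.scale_sum_right vector_smult_assoc
    by (intro sum.cong) auto
  ultimately show ?thesis unfolding taylor_coeff_def taylor_def by simp
qed

section \<open>Substituting a word series into a word-basis function\<close>

lemma sum_words_snoc:
  assumes "M \<noteq> {#}"
  shows "(\<Sum>w | mset w = M. F w) = (\<Sum>k\<in>set_mset M. \<Sum>w | mset w = M - {#k#}. F (w @ [k]))"
proof -
  have "(\<Sum>w | mset w = M. F w) = (\<Sum>(k, w)\<in>(SIGMA k:set_mset M. {w. mset w = M - {#k#}}). F (w @ [k]))"
  proof (rule sum.reindex_bij_witness[of _ "\<lambda>(k, w). w @ [k]" "\<lambda>w. (last w, butlast w)"])
    fix w assume "w \<in> {w. mset w = M}"
    moreover from this assms obtain w' k where "w = w' @ [k]" by (cases w rule: rev_cases) auto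
    ultimately show "(last w, butlast w) \<in> (SIGMA k:set_mset M. {w. mset w = M - {#k#}})"
      "(case (last w, butlast w) of (k, w) \<Rightarrow> w @ [k]) = w"
      "(case (last w, butlast w) of (k, w) \<Rightarrow> F (w @ [k])) = F w"
      by auto
  qed auto
  also have "\<dots> = (\<Sum>k\<in>set_mset M. \<Sum>w | mset w = M - {#k#}. F (w @ [k]))"
    by (rule sum.Sigma[symmetric]) (auto intro: finite_words_of_content)
  finally show ?thesis .
qed

text \<open>
  Choosing a nonempty submultiset and a letter in it amounts to choosing the letter first and then
  the rest of the submultiset.
\<close>

lemma sum_submultisets_letter:
  "(\<Sum>N | N \<subseteq># M \<and> N \<noteq> {#}. \<Sum>k\<in>set_mset N. F k (N - {#k#})) =
   (\<Sum>k\<in>set_mset M. \<Sum>K | K \<subseteq># M - {#k#}. F k K)"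
proof -
  have fin: "finite {N. N \<subseteq># K}" "finite {N. N \<subseteq># M \<and> N \<noteq> {#}}" for K
    by (auto intro: finite_submultisets finite_subset[OF _ finite_submultisets[of M]])
  have "(\<Sum>N | N \<subseteq># M \<and> N \<noteq> {#}. \<Sum>k\<in>set_mset N. F k (N - {#k#})) =
    (\<Sum>(N, k)\<in>(SIGMA N:{N. N \<subseteq># M \<and> N \<noteq> {#}}. set_mset N). F k (N - {#k#}))"
    by (rule sum.Sigma) (auto intro: fin)
  also have "\<dots> = (\<Sum>(k, K)\<in>(SIGMA k:set_mset M. {K. K \<subseteq># M - {#k#}}). F k K)"
    by (rule sum.reindex_bij_witness[of _ "\<lambda>(k, K). (add_mset k K, k)" "\<lambda>(N, k). (k, N - {#k#})"])
       (auto simp: insert_subset_eq_iff subset_eq_diff_conv mset_subset_eqD dest: mset_subset_eqD)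
  also have "\<dots> = (\<Sum>k\<in>set_mset M. \<Sum>K | K \<subseteq># M - {#k#}. F k K)"
    by (rule sum.Sigma[symmetric]) (auto intro: fin)
  finally show ?thesis .
qed

text \<open>
  The coefficient at \<open>M\<close> of \<open>\<Sum>\<^sub>w \<delta>\<^sub>w f\<^bsub>wu\<^esub>\<close>. For \<open>u = []\<close> this is the word series of \<open>\<delta>\<close>
  without its angle part.
\<close>

definition word_sum ::
  "('d::finite \<Rightarrow> 'n::finite) \<Rightarrow> (real^'n \<Rightarrow> real^'n) \<Rightarrow> ((int^'d) list \<Rightarrow> complex) \<Rightarrow>
    (int^'d) list \<Rightarrow> (int^'d) multiset \<Rightarrow> real^'n \<Rightarrow> complex^'n" where
  "word_sum \<iota> f \<delta> u M x = (\<Sum>w | mset w = M. \<delta> w *s word_fun \<iota> f (w @ u) x)"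

text \<open>
  With \<open>g = f\<^sub>u\<close> this says \<open>g(\<Sum>\<^sub>w \<delta>\<^sub>w f\<^sub>w) = \<Sum>\<^sub>w \<delta>\<^sub>w f\<^bsub>wu\<^esub>\<close>, that is, substitution acts as the
  differential operator \<open>\<Sum>\<^sub>w \<delta>\<^sub>w D\<^sub>w\<close> with \<open>D\<^sub>k g = (\<partial>g) f\<^sub>k\<close>. Coefficients that satisfy the shuffle
  relations have this property.
\<close>

definition substitutive ::
  "('d::finite \<Rightarrow> 'n::finite) \<Rightarrow> (real^'n \<Rightarrow> real^'n) \<Rightarrow> ((int^'d) list \<Rightarrow> complex) \<Rightarrow> real^'n \<Rightarrow> bool" where
  "substitutive \<iota> f \<delta> x \<longleftrightarrow> (\<forall>u M. u \<noteq> [] \<longrightarrow>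
     taylor (word_fun \<iota> f u) x (\<lambda>N. word_sum \<iota> f \<delta> [] N x) M = word_sum \<iota> f \<delta> u M x)"

lemma word_sum_empty: "word_sum \<iota> f \<delta> u {#} x = \<delta> [] *s word_fun \<iota> f u x"
  by (simp add: word_sum_def)

lemma word_sum_unit:
  "word_sum \<iota> f (\<lambda>w. if w = [] then 1 else 0) u M x = (if M = {#} then word_fun \<iota> f u x else 0)"
proof (cases "M = {#}")
  case False
  then have "(if w = [] then 1 else 0::complex) = 0" if "mset w = M" for w using that by auto
  then show ?thesis using False unfolding word_sum_def by (intro trans[OF sum.neutral]) auto
qed (simp add: word_sum_empty)

lemma substitutive_unit: "substitutive \<iota> f (\<lambda>w. if w = [] then 1 else 0) x"
proof -
  have "taylor (word_fun \<iota> f u) x (\<lambda>N. word_sum \<iota> f (\<lambda>w. if w = [] then 1 else 0) [] N x) M =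
     taylor (word_fun \<iota> f u) x (\<lambda>N. 0) M" for u M
    by (rule taylor_cong) (simp add: word_sum_unit)
  then show ?thesis unfolding substitutive_def word_sum_unit taylor_zero by simp
qed

lemma word_fun_Cons:
  "u \<noteq> [] \<Longrightarrow> word_fun \<iota> f (k # u) = (\<lambda>x. \<Sum>i\<in>UNIV. (word_fun \<iota> f [k] x $ i) *s partial_deriv i (word_fun \<iota> f u) x)"
  by (cases u) (auto simp: jacobian_mat_mult fun_eq_iff)

text \<open>
  The last letter of \<open>w\<close> stands next to \<open>u\<close> in \<open>wu\<close>, so differentiating \<open>\<delta>\<close> moves a letter from \<open>w\<close>
  to the front of \<open>u\<close>.
\<close>

lemma word_sum_has_vector_derivative:
  assumes d: "\<And>w k. ((\<lambda>t. \<delta> t (w @ [k])) has_vector_derivative \<rho> k * \<delta> t w) (at t)"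
    and "M \<noteq> {#}"
  shows "((\<lambda>t. word_sum \<iota> f (\<delta> t) u M x) has_vector_derivative
    (\<Sum>k\<in>set_mset M. \<rho> k *s word_sum \<iota> f (\<delta> t) (k # u) (M - {#k#}) x)) (at t)"
proof -
  have "((\<lambda>t. \<delta> t (w @ [k]) *s word_fun \<iota> f ((w @ [k]) @ u) x) has_vector_derivative
       \<rho> k *s (\<delta> t w *s word_fun \<iota> f (w @ k # u) x)) (at t)" for w k
    using bounded_linear.has_vector_derivative[OF bounded_bilinear.bounded_linear_left[OF bounded_bilinear_smult] d]
    by (simp add: vector_smult_assoc)
  then show ?thesis
    unfolding word_sum_def sum_words_snoc[OF assms(2)] vec.scale_sum_right
    by (intro has_vector_derivative_sum)
qed

text \<open>
  \<open>f\<^bsub>ku\<^esub>\<close> is a sum of products of components of \<open>f\<^sub>k\<close> with partial derivatives of \<open>f\<^sub>u\<close>, and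
  substitution respects sums and products.
\<close>

lemma taylor_word_fun_Cons:
  assumes f: "smooth f" and u: "u \<noteq> []"
  shows "taylor (word_fun \<iota> f (k # u)) p c M =
    (\<Sum>K | K \<subseteq># M. \<Sum>i\<in>UNIV. (taylor (word_fun \<iota> f [k]) p c K $ i) *s taylor (partial_deriv i (word_fun \<iota> f u)) p c (M - K))"
proof -
  note s = smooth_word_fun[OF f]
  show ?thesis
    unfolding word_fun_Cons[OF u]
    by (subst taylor_sum) (auto intro!: smooth_nth_smult smooth_partial_deriv s simp del: word_fun.simps
        simp add: taylor_product[OF s smooth_partial_deriv[OF s]] sum.swap[of _ UNIV "{K. K \<subseteq># M}"])
qed

text \<open>
  The core of the proof, in place of the shuffle relations. Along such a family \<open>\<delta>\<^sub>t\<close>, both sides of the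
  defining identity satisfy \<open>X\<^sub>u[M]' = \<Sum>\<^sub>k \<rho>\<^sub>k X\<^bsub>ku\<^esub>[M - k]\<close>. For the right-hand side this is the
  derivative of a word sum. On the left, the chain rule produces the derivative of the series, whose
  coefficients are themselves word sums \<open>\<Sum>\<^sub>k \<rho>\<^sub>k Y\<^sub>k[N - k]\<close>; by induction on the size of the
  monomial these are expansions of \<open>f\<^sub>k\<close>, and multiplicativity of substitution assembles them with the
  partial derivatives of \<open>f\<^sub>u\<close> into the expansion of \<open>f\<^bsub>ku\<^esub>\<close>. So the identity propagates from
  \<open>t = 0\<close> to all \<open>t\<close>.
\<close>

lemma substitutive_evolution:
  fixes \<iota> :: "'d::finite \<Rightarrow> 'n::finite"
  assumes f: "smooth f"
    and unit: "\<And>t. \<delta> t [] = 1"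
    and d: "\<And>t w k. ((\<lambda>t. \<delta> t (w @ [k])) has_vector_derivative \<rho> t k * \<delta> t w) (at t)"
    and init: "substitutive \<iota> f (\<delta> 0) x"
  shows "substitutive \<iota> f (\<delta> t) x"
proof -
  define c where "c = (\<lambda>t N. word_sum \<iota> f (\<delta> t) [] N x)"
  define c' where "c' = (\<lambda>t N. \<Sum>k\<in>set_mset N. \<rho> t k *s word_sum \<iota> f (\<delta> t) [k] (N - {#k#}) x)"
  have dc: "((\<lambda>t. c t N) has_vector_derivative c' t N) (at t)" if "N \<noteq> {#}" for t N
    unfolding c_def c'_def by (rule word_sum_has_vector_derivative[OF d that])
  note s = smooth_word_fun[OF f]
  have "taylor (word_fun \<iota> f u) x (c t) M = word_sum \<iota> f (\<delta> t) u M x" if "u \<noteq> []" for u M t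
    using that
  proof (induction "size M" arbitrary: M u t rule: less_induct)
    case less
    note u = less.prems
    show ?case
    proof (cases "M = {#}")
      case True
      then show ?thesis by (simp add: word_sum_empty unit)
    next
      case False
      have IH: "taylor (word_fun \<iota> f v) x (c t) (N - {#k#}) = word_sum \<iota> f (\<delta> t) v (N - {#k#}) x"
        if "v \<noteq> []" "k \<in># N" "N \<subseteq># M" for v k N t
      proof (rule less.hyps[OF _ that(1)])
        have "size (N - {#k#}) < size N" using that(2) by (simp add: size_Diff1_less)
        then show "size (N - {#k#}) < size M" using size_mset_mono[OF that(3)] by simp
      qed
      have X: "((\<lambda>t. taylor (word_fun \<iota> f u) x (c t) M) has_vector_derivative
          (\<Sum>k\<in>set_mset M. \<rho> t k *s word_sum \<iota> f (\<delta> t) (k # u) (M - {#k#}) x)) (at t)" for t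
      proof -
        let ?F = "\<lambda>k K. \<Sum>i\<in>UNIV. (taylor (word_fun \<iota> f [k]) x (c t) K $ i) *s
              taylor (partial_deriv i (word_fun \<iota> f u)) x (c t) (M - {#k#} - K)"
        have "(\<Sum>i\<in>UNIV. (c' t N $ i) *s taylor (partial_deriv i (word_fun \<iota> f u)) x (c t) (M - N)) =
          (\<Sum>k\<in>set_mset N. \<rho> t k *s ?F k (N - {#k#}))" if N: "N \<subseteq># M" for N
        proof -
          have e: "M - {#k#} - (N - {#k#}) = M - N" if "k \<in># N" for k
            using that by (metis diff_diff_add insert_DiffM add_mset_add_single add.commute)
          have "c' t N = (\<Sum>k\<in>set_mset N. \<rho> t k *s taylor (word_fun \<iota> f [k]) x (c t) (N - {#k#}))"
            unfolding c'_def using N by (intro sum.cong refl) (simp add: IH del: word_fun.simps)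
          then have "(\<Sum>i\<in>UNIV. (c' t N $ i) *s taylor (partial_deriv i (word_fun \<iota> f u)) x (c t) (M - N)) =
            (\<Sum>i\<in>UNIV. \<Sum>k\<in>set_mset N. (\<rho> t k * (taylor (word_fun \<iota> f [k]) x (c t) (N - {#k#}) $ i)) *s
               taylor (partial_deriv i (word_fun \<iota> f u)) x (c t) (M - N))"
            by (simp add: vec.scale_sum_left del: word_fun.simps)
          also have "\<dots> = (\<Sum>k\<in>set_mset N. \<rho> t k *s ?F k (N - {#k#}))"
            by (subst sum.swap) (intro sum.cong refl, simp only: e vec.scale_sum_right vector_smult_assoc)
          finally show ?thesis .
        qed
        then have "(\<Sum>N | N \<subseteq># M \<and> N \<noteq> {#}. \<Sum>i\<in>UNIV. (c' t N $ i) *s taylor (partial_deriv i (word_fun \<iota> f u)) x (c t) (M - N))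
          = (\<Sum>N | N \<subseteq># M \<and> N \<noteq> {#}. \<Sum>k\<in>set_mset N. \<rho> t k *s ?F k (N - {#k#}))"
          by (intro sum.cong refl) blast
        also have "\<dots> = (\<Sum>k\<in>set_mset M. \<Sum>K | K \<subseteq># M - {#k#}. \<rho> t k *s ?F k K)"
          by (rule sum_submultisets_letter)
        also have "\<dots> = (\<Sum>k\<in>set_mset M. \<rho> t k *s word_sum \<iota> f (\<delta> t) (k # u) (M - {#k#}) x)"
        proof (intro sum.cong refl)
          fix k assume "k \<in># M"
          then show "(\<Sum>K | K \<subseteq># M - {#k#}. \<rho> t k *s ?F k K) = \<rho> t k *s word_sum \<iota> f (\<delta> t) (k # u) (M - {#k#}) x"
            using IH[of "k # u" k M t] taylor_word_fun_Cons[OF f u, of \<iota> k x "c t" "M - {#k#}"]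
            by (simp only: vec.scale_sum_right[symmetric]) simp
        qed
        finally show ?thesis
          using taylor_has_vector_derivative[where c=c and c'="c' t" and p=x and M=M, OF dc s[of \<iota> u]] by simp
      qed
      have Y: "((\<lambda>t. word_sum \<iota> f (\<delta> t) u M x) has_vector_derivative
          (\<Sum>k\<in>set_mset M. \<rho> t k *s word_sum \<iota> f (\<delta> t) (k # u) (M - {#k#}) x)) (at t)" for t
        by (rule word_sum_has_vector_derivative[OF d False])
      have "taylor (word_fun \<iota> f u) x (c 0) M = word_sum \<iota> f (\<delta> 0) u M x"
        using init u unfolding substitutive_def c_def by blast
      from eq_if_same_vector_derivative[OF X Y this] show ?thesis .
    qed
  qed
  then show ?thesis unfolding substitutive_def c_def by blast
qed

section \<open>Expansions of word series\<close>

lemma word_series_eq: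
  "word_series \<iota> f v \<delta> M x = (if M = {#} then angle_vec \<iota> v else 0) + word_sum \<iota> f \<delta> [] M x"
  by (simp add: word_series_def word_sum_def)

lemma angle_vec_cvec: "angle_vec \<iota> (cvec v) = cvec (angle_vec \<iota> v)"
  by (simp add: angle_vec_def cvec_def vec_eq_iff)

lemma cvec_add: "cvec (x + y) = cvec x + cvec y"
  by (simp add: cvec_def vec_eq_iff)

lemma base_point_word_series:
  assumes "\<delta> [] = 1"
  shows "base_point (word_series \<iota> f (cvec v) \<delta>) x = x + angle_vec \<iota> v"
  using assms by (simp add: base_point_def word_series_eq word_sum_empty angle_vec_cvec vec_eq_iff) (simp add: cvec_def)

lemma taylor_coeff_const: "taylor_coeff (\<lambda>x. v) G M x = (if M = {#} then v else 0)"
  by (simp add: taylor_coeff_eq_taylor taylor_const)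

text \<open>
  An extended word series is the rotation by \<open>v\<close> of a plain one: its angle part only moves the base
  point of the expansion, which multiplies \<open>f\<^sub>u\<close> by its phase.
\<close>

lemma taylor_coeff_word_fun:
  assumes "inj \<iota>" "smooth f" "\<delta> [] = 1" "substitutive \<iota> f \<delta> x" "u \<noteq> []"
  shows "taylor_coeff (word_fun \<iota> f u) (word_series \<iota> f (cvec v) \<delta>) M x =
    exp (\<i> * complex_of_real (sum_list (map freq u) \<bullet> v)) *s word_sum \<iota> f \<delta> u M x"
proof -
  have "taylor_coeff (word_fun \<iota> f u) (word_series \<iota> f (cvec v) \<delta>) M x =
     taylor (word_fun \<iota> f u) (x + angle_vec \<iota> v) (\<lambda>N. word_sum \<iota> f \<delta> [] N x) M"
    unfolding taylor_coeff_eq_taylor base_point_word_series[of \<delta>, OF assms(3)]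
    by (rule taylor_cong) (simp add: word_series_eq)
  also have "\<dots> = exp (\<i> * complex_of_real (sum_list (map freq u) \<bullet> v)) *s
     taylor (word_fun \<iota> f u) x (\<lambda>N. word_sum \<iota> f \<delta> [] N x) M"
    by (rule taylor_translate[OF smooth_word_fun[OF assms(2)] word_fun_rotate[OF assms(1,2,5)]])
  finally show ?thesis using assms(4,5) unfolding substitutive_def by simp
qed

lemma taylor_coeff_cvec:
  assumes "\<delta> [] = 1"
  shows "taylor_coeff cvec (word_series \<iota> f (cvec v) \<delta>) M x = word_series \<iota> f (cvec v) \<delta> M x"
  by (cases "M = {#}")
     (simp_all add: taylor_coeff_eq_taylor taylor_cvec base_point_word_series[of \<delta>, OF assms]
       word_series_eq word_sum_empty assms cvec_add angle_vec_cvec add.commute)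

section \<open>Formal flows are word series\<close>

text \<open>
  The field has only a constant term and one term per letter, so the sum over submultisets in the
  substitution collapses. The parameters \<open>\<omega>\<close> and \<open>a\<close> cover the full field, the rotation and the
  perturbation at once.
\<close>

lemma fexp_subst_linear_field:
  assumes f: "smooth f"
  shows "fexp_subst (\<lambda>M x. rotation_field \<iota> \<omega> M x + a *s perturbation_field \<iota> f M x) G M x =
    (if M = {#} then angle_vec \<iota> (cvec \<omega>) else 0) +
    (\<Sum>k\<in>set_mset M. a *s taylor_coeff (word_fun \<iota> f [k]) G (M - {#k#}) x)"
proof -
  let ?V = "\<lambda>M x. rotation_field \<iota> \<omega> M x + a *s perturbation_field \<iota> f M x"
  have e: "?V {#} = (\<lambda>x. angle_vec \<iota> (cvec \<omega>))"
    by (simp add: rotation_field_def perturbation_field_def)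
  have l: "?V {#k#} = (\<lambda>x. a *s word_fun \<iota> f [k] x)" for k
    by (simp add: rotation_field_def perturbation_field_def)
  have z: "?V N = (\<lambda>x. 0)" if "N \<noteq> {#}" "\<And>k. N \<noteq> {#k#}" for N
    using that by (simp add: rotation_field_def perturbation_field_def)
  have "fexp_subst ?V G M x = (\<Sum>N\<in>insert {#} ((\<lambda>k. {#k#}) ` set_mset M). taylor_coeff (?V N) G (M - N) x)"
    unfolding fexp_subst_def
  proof (rule sum.mono_neutral_right[OF finite_submultisets])
    show "\<forall>N\<in>{N. N \<subseteq># M} - insert {#} ((\<lambda>k. {#k#}) ` set_mset M). taylor_coeff (?V N) G (M - N) x = 0"
    proof
      fix N assume N: "N \<in> {N. N \<subseteq># M} - insert {#} ((\<lambda>k. {#k#}) ` set_mset M)"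
      then have "N \<noteq> {#k#}" for k by (cases "k \<in># M") (auto dest: mset_subset_eqD)
      then have "?V N = (\<lambda>x. 0)" using N by (intro z) auto
      then show "taylor_coeff (?V N) G (M - N) x = 0" by (simp only:) (simp add: taylor_coeff_const)
    qed
  qed auto
  also have "\<dots> = taylor_coeff (?V {#}) G M x + (\<Sum>N\<in>(\<lambda>k. {#k#}) ` set_mset M. taylor_coeff (?V N) G (M - N) x)"
    by (subst sum.insert) auto
  also have "(\<Sum>N\<in>(\<lambda>k. {#k#}) ` set_mset M. taylor_coeff (?V N) G (M - N) x) =
     (\<Sum>k\<in>set_mset M. taylor_coeff (?V {#k#}) G (M - {#k#}) x)"
    by (subst sum.reindex) (auto simp: inj_on_def)
  finally show ?thesis
    unfolding e l taylor_coeff_const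
    by (simp only: taylor_coeff_eq_taylor taylor_smult[OF smooth_word_fun[OF f]])
qed

lemma taylor_coeff_cong:
  assumes "\<And>N. N \<subseteq># M \<Longrightarrow> G N x = G' N x"
  shows "taylor_coeff g G M x = taylor_coeff g G' M x"
proof -
  have "base_point G x = base_point G' x" using assms[of "{#}"] by (simp add: base_point_def)
  then show ?thesis unfolding taylor_coeff_eq_taylor using assms by (metis taylor_cong)
qed

text \<open>
  The word series satisfies the flow equation by substitutivity. The right-hand side of the
  equation at \<open>M\<close> only involves smaller monomials, so by induction on the size of \<open>M\<close> any flow
  has the same derivative and the same initial value as the word series.
\<close>

lemma formal_flow_eq_word_series:
  fixes \<iota> :: "'d::finite \<Rightarrow> 'n::finite"
  assumes \<iota>: "inj \<iota>" and f: "smooth f"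
    and flow: "formal_flow (\<lambda>M x. rotation_field \<iota> \<omega> M x + a *s perturbation_field \<iota> f M x) \<Phi>"
    and unit: "\<And>t. \<delta> t [] = 1" and init: "\<And>w. w \<noteq> [] \<Longrightarrow> \<delta> 0 w = 0"
    and d: "\<And>t w k. ((\<lambda>t. \<delta> t (w @ [k])) has_vector_derivative
       a * exp (\<i> * complex_of_real (t * (freq k \<bullet> \<omega>))) * \<delta> t w) (at t)"
  shows "\<Phi> t = word_series \<iota> f (cvec (t *\<^sub>R \<omega>)) (\<delta> t)"
proof -
  define W where "W = (\<lambda>t. word_series \<iota> f (cvec (t *\<^sub>R \<omega>)) (\<delta> t))"
  have \<delta>0: "\<delta> 0 = (\<lambda>w. if w = [] then 1 else 0)" using unit init by auto
  have sub: "substitutive \<iota> f (\<delta> t) x" for t x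
    by (rule substitutive_evolution[OF f unit d]) (simp add: \<delta>0 substitutive_unit)
  have \<Phi>0: "\<Phi> 0 = fexp_id"
    and \<Phi>': "((\<lambda>s. \<Phi> s M x) has_vector_derivative fexp_subst (\<lambda>M x. rotation_field \<iota> \<omega> M x + a *s perturbation_field \<iota> f M x) (\<Phi> t) M x) (at t)" for t M x
    using flow unfolding formal_flow_def by auto
  have W0: "W 0 M x = fexp_id M x" for M x
  proof -
    have "angle_vec \<iota> (cvec (0 :: real^'d)) = 0" by (simp add: angle_vec_def cvec_def vec_eq_iff)
    then show ?thesis unfolding W_def \<delta>0 word_series_eq word_sum_unit fexp_id_def by simp
  qed
  have W': "((\<lambda>s. W s M x) has_vector_derivative fexp_subst (\<lambda>M x. rotation_field \<iota> \<omega> M x + a *s perturbation_field \<iota> f M x) (W t) M x) (at t)" for t M x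
  proof (cases "M = {#}")
    case True
    have "((\<lambda>s. s *\<^sub>R angle_vec \<iota> (cvec \<omega>) + cvec x) has_vector_derivative angle_vec \<iota> (cvec \<omega>)) (at t)"
      by (auto intro!: derivative_eq_intros)
    moreover have "W s M x = s *\<^sub>R angle_vec \<iota> (cvec \<omega>) + cvec x" for s
    proof -
      have "angle_vec \<iota> (cvec (s *\<^sub>R \<omega>)) = s *\<^sub>R angle_vec \<iota> (cvec \<omega>)"
        by (simp add: angle_vec_def cvec_def vec_eq_iff) (simp add: scaleR_conv_of_real)
      then show ?thesis using True unit by (simp add: W_def word_series_eq word_sum_empty)
    qed
    ultimately show ?thesis using True by (simp add: fexp_subst_linear_field[OF f])
  next
    case False
    have e: "exp (\<i> * complex_of_real (sum_list (map freq [k]) \<bullet> t *\<^sub>R \<omega>)) = exp (\<i> * complex_of_real (t * (freq k \<bullet> \<omega>)))" for k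
      by simp
    show ?thesis
      unfolding W_def fexp_subst_linear_field[OF f] taylor_coeff_word_fun[OF \<iota> f unit sub not_Cons_self2] e
      using word_sum_has_vector_derivative[where \<delta>=\<delta> and f=f and \<iota>=\<iota> and u="[]" and x=x, OF d False] False
      by (simp add: word_series_eq vector_smult_assoc)
  qed
  have "\<Phi> t M x = W t M x" for t M x
  proof (induction "size M" arbitrary: M t rule: less_induct)
    case less
    have "taylor_coeff (word_fun \<iota> f [k]) (\<Phi> t) (M - {#k#}) x = taylor_coeff (word_fun \<iota> f [k]) (W t) (M - {#k#}) x" if "k \<in># M" for t k
    proof (rule taylor_coeff_cong)
      fix N assume "N \<subseteq># M - {#k#}"
      then have "size N \<le> size (M - {#k#})" by (rule size_mset_mono)
      also have "\<dots> < size M" using that by (simp add: size_Diff1_less)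
      finally show "\<Phi> t N x = W t N x" by (rule less)
    qed
    then have "fexp_subst (\<lambda>M x. rotation_field \<iota> \<omega> M x + a *s perturbation_field \<iota> f M x) (\<Phi> t) M x =
      fexp_subst (\<lambda>M x. rotation_field \<iota> \<omega> M x + a *s perturbation_field \<iota> f M x) (W t) M x" for t
      unfolding fexp_subst_linear_field[OF f] by (simp del: word_fun.simps)
    then have d\<Phi>: "((\<lambda>s. \<Phi> s M x) has_vector_derivative fexp_subst (\<lambda>M x. rotation_field \<iota> \<omega> M x + a *s perturbation_field \<iota> f M x) (W t) M x) (at t)" for t
      using \<Phi>'[of M x t] by simp
    have "\<Phi> 0 M x = W 0 M x" by (simp add: W0 \<Phi>0)
    then show ?case
      using eq_if_same_vector_derivative[where X="\<lambda>s. \<Phi> s M x" and Y="\<lambda>s. W s M x", OF d\<Phi> W'] by blast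
  qed
  then show ?thesis unfolding W_def by blast
qed

section \<open>Composition of word series\<close>

lemma sum_words_split:
  "(\<Sum>N | N \<subseteq># M. \<Sum>u | mset u = N. \<Sum>w | mset w = M - N. F w u) =
   (\<Sum>w | mset w = M. \<Sum>j\<le>length w. F (take j w) (drop j w))"
proof -
  have "(\<Sum>N | N \<subseteq># M. \<Sum>u | mset u = N. \<Sum>w | mset w = M - N. F w u) =
    (\<Sum>(N, u, w)\<in>(SIGMA N:{N. N \<subseteq># M}. {u. mset u = N} \<times> {w. mset w = M - N}). F w u)"
    by (simp add: sum.Sigma finite_submultisets finite_words_of_content case_prod_beta sum.cartesian_product)
  also have "\<dots> = (\<Sum>(w, j)\<in>(SIGMA w:{w. mset w = M}. {..length w}). F (take j w) (drop j w))"
  proof (rule sum.reindex_bij_witness[of _ "\<lambda>(w, j). (mset (drop j w), drop j w, take j w)" "\<lambda>(N, u, w). (w @ u, length w)"])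
    fix p assume "p \<in> (SIGMA w:{w. mset w = M}. {..length w})"
    then obtain w j where p: "p = (w, j)" "mset w = M" "j \<le> length w" by auto
    have "mset (take j w @ drop j w) = M" using p by (simp only: append_take_drop_id)
    then have "mset (take j w) + mset (drop j w) = M" by (simp only: mset_append)
    then show "(case p of (w, j) \<Rightarrow> (mset (drop j w), drop j w, take j w)) \<in> (SIGMA N:{N. N \<subseteq># M}. {u. mset u = N} \<times> {w. mset w = M - N})"
      using p by auto
    show "(case case p of (w, j) \<Rightarrow> (mset (drop j w), drop j w, take j w) of (N, u, w) \<Rightarrow> (w @ u, length w)) = p"
      using p by simp
  qed auto
  also have "\<dots> = (\<Sum>w | mset w = M. \<Sum>j\<le>length w. F (take j w) (drop j w))"
    by (simp add: sum.Sigma finite_words_of_content)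
  finally show ?thesis .
qed

text \<open>
  Deconcatenation (convolution) product of \<open>\<delta>\<close> and \<open>\<beta>\<close>, twisted by the phases that the rotation
  by \<open>v\<close> puts on the right factor.
\<close>

definition compose_coeff ::
  "((int^'d::finite) list \<Rightarrow> complex) \<Rightarrow> real^'d \<Rightarrow> ((int^'d) list \<Rightarrow> complex) \<Rightarrow> (int^'d) list \<Rightarrow> complex" where
  "compose_coeff \<delta> v \<beta> w = (\<Sum>j\<le>length w. \<delta> (take j w) *
     (exp (\<i> * complex_of_real (sum_list (map freq (drop j w)) \<bullet> v)) * \<beta> (drop j w)))"

text \<open>
  Each \<open>f\<^sub>u\<close> in the outer series becomes \<open>exp (i k\<^sub>u \<cdot> v) \<Sum>\<^sub>w \<delta>\<^sub>w f\<^bsub>wu\<^esub>\<close>, so the coefficient of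
  a word is the sum over its cuts into \<open>w\<close> and \<open>u\<close>. The empty word \<open>u\<close> stands for the identity
  map and adds the angle parts.
\<close>

lemma fexp_subst_word_series:
  assumes \<iota>: "inj \<iota>" and f: "smooth f" and \<delta>: "\<delta> [] = 1" "\<And>x. substitutive \<iota> f \<delta> x" and \<beta>: "\<beta> [] = 1"
  shows "fexp_subst (word_series \<iota> f (cvec v') \<beta>) (word_series \<iota> f (cvec v) \<delta>) =
    word_series \<iota> f (cvec (v + v')) (compose_coeff \<delta> v \<beta>)"
proof (intro ext)
  fix M x
  let ?e = "\<lambda>u. exp (\<i> * complex_of_real (sum_list (map freq u) \<bullet> v))"
  let ?G = "word_series \<iota> f (cvec v) \<delta>" and ?F = "word_series \<iota> f (cvec v') \<beta>"
  have "taylor_coeff (?F N) ?G (M - N) x = (if N = {#} \<and> M = {#} then cvec (angle_vec \<iota> (v + v')) else 0) +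
     (\<Sum>u | mset u = N. \<Sum>w | mset w = M - N. (\<delta> w * (?e u * \<beta> u)) *s word_fun \<iota> f (w @ u) x)" for N
  proof (cases "N = {#}")
    case True
    have "?F N = (\<lambda>x. angle_vec \<iota> (cvec v') + cvec x)"
      using True \<beta> by (simp add: fun_eq_iff word_series_eq word_sum_empty)
    then have "taylor_coeff (?F N) ?G (M - N) x = (if M = {#} then angle_vec \<iota> (cvec v') else 0) + taylor_coeff cvec ?G M x"
      using True by (simp add: taylor_coeff_eq_taylor taylor_add smooth_const smooth_bounded_linear bounded_linear_cvec taylor_const)
    then show ?thesis
      using True \<beta> \<delta>(1) unfolding taylor_coeff_cvec[of \<delta>, OF \<delta>(1)] word_series_eq word_sum_def
      by (simp add: angle_vec_cvec linear_add[OF bounded_linear.linear[OF bounded_linear_angle_vec]] cvec_add add.commute)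
  next
    case False
    have "?F N = (\<lambda>x. \<Sum>u | mset u = N. \<beta> u *s word_fun \<iota> f u x)"
      using False by (simp add: fun_eq_iff word_series_def)
    then have "taylor_coeff (?F N) ?G (M - N) x = (\<Sum>u | mset u = N. \<beta> u *s taylor_coeff (word_fun \<iota> f u) ?G (M - N) x)"
      by (simp add: taylor_coeff_eq_taylor taylor_sum taylor_smult smooth_smult smooth_word_fun f finite_words_of_content)
    also have "\<dots> = (\<Sum>u | mset u = N. \<Sum>w | mset w = M - N. (\<delta> w * (?e u * \<beta> u)) *s word_fun \<iota> f (w @ u) x)"
    proof (intro sum.cong refl)
      fix u assume "u \<in> {u. mset u = N}"
      then have "u \<noteq> []" using False by auto
      from taylor_coeff_word_fun[of _ _ \<delta>, OF \<iota> f \<delta> this]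
      show "\<beta> u *s taylor_coeff (word_fun \<iota> f u) ?G (M - N) x = (\<Sum>w | mset w = M - N. (\<delta> w * (?e u * \<beta> u)) *s word_fun \<iota> f (w @ u) x)"
        by (simp add: word_sum_def vec.scale_sum_right vector_smult_assoc mult_ac)
    qed
    finally show ?thesis using False by simp
  qed
  then have "fexp_subst ?F ?G M x = (\<Sum>N | N \<subseteq># M. if N = {#} \<and> M = {#} then cvec (angle_vec \<iota> (v + v')) else 0) +
     (\<Sum>N | N \<subseteq># M. \<Sum>u | mset u = N. \<Sum>w | mset w = M - N. (\<delta> w * (?e u * \<beta> u)) *s word_fun \<iota> f (w @ u) x)"
    unfolding fexp_subst_def by (simp add: sum.distrib)
  also have "(\<Sum>N | N \<subseteq># M. if N = {#} \<and> M = {#} then cvec (angle_vec \<iota> (v + v')) else 0) =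
     (if M = {#} then angle_vec \<iota> (cvec (v + v')) else 0)"
    by (cases "M = {#}") (simp_all add: angle_vec_cvec Collect_conv_if)
  finally show "fexp_subst ?F ?G M x = word_series \<iota> f (cvec (v + v')) (compose_coeff \<delta> v \<beta>) M x"
    unfolding sum_words_split by (simp add: word_series_def compose_coeff_def vec.scale_sum_left)
qed

lemma compose_coeff_unit: "compose_coeff \<delta> v (\<lambda>w. if w = [] then 1 else 0) = \<delta>"
proof
  fix w
  have "compose_coeff \<delta> v (\<lambda>w. if w = [] then 1 else 0) w = (\<Sum>j\<le>length w. if j = length w then \<delta> w else 0)"
    unfolding compose_coeff_def by (intro sum.cong refl) auto
  then show "compose_coeff \<delta> v (\<lambda>w. if w = [] then 1 else 0) w = \<delta> w" by simp
qed

lemma compose_coeff_Nil: "compose_coeff \<delta> v \<beta> [] = \<delta> [] * \<beta> []"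
  by (simp add: compose_coeff_def)

definition taylor_flow_coeff :: "real \<Rightarrow> 'a list \<Rightarrow> complex" where
  "taylor_flow_coeff t w = complex_of_real (t ^ length w / fact (length w))"

lemma taylor_flow_coeff_simps [simp]: "taylor_flow_coeff t [] = 1" "w \<noteq> [] \<Longrightarrow> taylor_flow_coeff 0 w = 0"
  by (simp_all add: taylor_flow_coeff_def)

lemma taylor_flow_coeff_0: "taylor_flow_coeff 0 = (\<lambda>w. if w = [] then 1 else 0)"
  by auto

lemma taylor_flow_coeff_derivative:
  "((\<lambda>t. taylor_flow_coeff t (w @ [k])) has_vector_derivative taylor_flow_coeff t w) (at t)"
proof -
  have "((\<lambda>t. t ^ Suc (length w) / fact (Suc (length w))) has_real_derivative t ^ length w / fact (length w)) (at t)"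
    by (auto intro!: derivative_eq_intros simp: field_simps simp del: power_Suc of_nat_Suc)
  moreover have "length (w @ [k]) = Suc (length w)" by simp
  ultimately show ?thesis
    unfolding taylor_flow_coeff_def
    by (simp only: has_real_derivative_iff_has_vector_derivative has_vector_derivative_of_real)
qed

text \<open>
  The cut after the last letter \<open>k\<close> does not depend on \<open>t\<close>. In every other cut \<open>k\<close> ends the right
  factor, where it is removed by differentiation and leaves its phase. This is the form required by
  \<open>substitutive_evolution\<close>, with a rate that is constant in time.
\<close>

lemma compose_coeff_derivative:
  "((\<lambda>t. compose_coeff \<delta> v (taylor_flow_coeff t) (w @ [k])) has_vector_derivative
     exp (\<i> * complex_of_real (freq k \<bullet> v)) * compose_coeff \<delta> v (taylor_flow_coeff t) w) (at t)"
proof -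
  let ?e = "\<lambda>u. exp (\<i> * complex_of_real (sum_list (map freq u) \<bullet> v))"
  have e: "?e (u @ [k]) = exp (\<i> * complex_of_real (freq k \<bullet> v)) * ?e u" for u
    by (simp add: inner_add_left distrib_left exp_add mult.commute)
  have "compose_coeff \<delta> v (taylor_flow_coeff t) (w @ [k]) =
     (\<Sum>j\<le>length w. (\<delta> (take j w) * ?e (drop j w @ [k])) * taylor_flow_coeff t (drop j w @ [k])) + \<delta> (w @ [k])" for t
    unfolding compose_coeff_def by (simp add: mult.assoc)
  moreover have "((\<lambda>t. (\<Sum>j\<le>length w. (\<delta> (take j w) * ?e (drop j w @ [k])) * taylor_flow_coeff t (drop j w @ [k])) + \<delta> (w @ [k]))
     has_vector_derivative (\<Sum>j\<le>length w. (\<delta> (take j w) * ?e (drop j w @ [k])) * taylor_flow_coeff t (drop j w)) + 0) (at t)"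
    by (intro has_vector_derivative_add has_vector_derivative_sum has_vector_derivative_const
        bounded_linear.has_vector_derivative[OF bounded_linear_mult_right] taylor_flow_coeff_derivative)
  moreover have "(\<Sum>j\<le>length w. (\<delta> (take j w) * ?e (drop j w @ [k])) * taylor_flow_coeff t (drop j w)) =
     exp (\<i> * complex_of_real (freq k \<bullet> v)) * compose_coeff \<delta> v (taylor_flow_coeff t) w"
    unfolding e compose_coeff_def sum_distrib_left by (simp only: mult_ac)
  ultimately show ?thesis by simp
qed

lemma substitutive_compose:
  assumes "smooth f" "\<delta> [] = 1" "substitutive \<iota> f \<delta> x"
  shows "substitutive \<iota> f (compose_coeff \<delta> v (taylor_flow_coeff t)) x"
  by (rule substitutive_evolution[OF assms(1) _ compose_coeff_derivative])
     (simp_all add: assms compose_coeff_Nil taylor_flow_coeff_0 compose_coeff_unit)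

section \<open>Coefficients of the splitting integrator\<close>

lemma run_factorial_replicate: "run_factorial (replicate m x) = fact m"
proof (cases m)
  case (Suc m')
  have "takeWhile (\<lambda>i. i = x) (replicate m' x) = replicate m' x" "dropWhile (\<lambda>i. i = x) (replicate m' x) = []"
    by (simp_all add: takeWhile_eq_all_conv)
  then show ?thesis using Suc by simp
qed simp

lemma run_factorial_append_replicate:
  "x \<notin> set js \<Longrightarrow> run_factorial (js @ replicate m x) = run_factorial js * fact m"
proof (induction js rule: run_factorial.induct)
  case 1
  then show ?case by (simp add: run_factorial_replicate)
next
  case (2 j js)
  let ?D = "dropWhile (\<lambda>i. i = j) (j # js)" and ?T = "takeWhile (\<lambda>i. i = j) (j # js)"
  have x: "x \<noteq> j" "x \<notin> set ?D" using 2(2) by (auto dest: set_dropWhileD)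
  have r: "takeWhile (\<lambda>i. i = j) (replicate m x) = []" "dropWhile (\<lambda>i. i = j) (replicate m x) = replicate m x"
    using x by (cases m; simp)+
  have "takeWhile (\<lambda>i. i = j) ((j # js) @ replicate m x) = ?T \<and>
    dropWhile (\<lambda>i. i = j) ((j # js) @ replicate m x) = ?D @ replicate m x"
  proof (cases "\<forall>i\<in>set (j # js). i = j")
    case True
    then have "?T = j # js" "?D = []" by (simp_all only: takeWhile_eq_all_conv dropWhile_eq_Nil_conv)
    moreover have "takeWhile (\<lambda>i. i = j) ((j # js) @ replicate m x) = (j # js) @ takeWhile (\<lambda>i. i = j) (replicate m x)"
      "dropWhile (\<lambda>i. i = j) ((j # js) @ replicate m x) = dropWhile (\<lambda>i. i = j) (replicate m x)"
      using True by (intro takeWhile_append2 dropWhile_append2; blast)+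
    ultimately show ?thesis by (simp only: r append_Nil append_Nil2)
  next
    case False
    then obtain i where "i \<in> set (j # js)" "\<not> i = j" by blast
    from takeWhile_append1[where P="\<lambda>i. i = j", OF this] dropWhile_append1[where P="\<lambda>i. i = j", OF this]
    show ?thesis by blast
  qed
  then have "run_factorial ((j # js) @ replicate m x) = fact (length ?T) * run_factorial (?D @ replicate m x)"
    by (simp only: append_Cons run_factorial.simps)
  then show ?case using 2(1)[OF x(2)] by (simp only: run_factorial.simps mult.assoc)
qed

lemma sum_nth_eq_sum_list_zip:
  "length js = length w \<Longrightarrow> (\<Sum>l<length w. F (js ! l) (w ! l)) = sum_list (map (\<lambda>(j, k). F j k) (zip js w))"
  by (simp add: sum_list_sum_nth atLeast0LessThan)

text \<open>
  A sorted list with entries up to \<open>Suc r\<close> ends in a run of entries \<open>Suc r\<close>, and what precedes the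
  run is a sorted list with entries up to \<open>r\<close>.
\<close>

lemma sum_sorted_lists_Suc:
  "(\<Sum>js | length js = n \<and> sorted js \<and> set js \<subseteq> {1..Suc r}. F js) =
   (\<Sum>j\<le>n. \<Sum>js | length js = j \<and> sorted js \<and> set js \<subseteq> {1..r}. F (js @ replicate (n - j) (Suc r)))"
proof -
  have fin: "finite {js. length js = j \<and> sorted js \<and> set js \<subseteq> {1..r}}" for j
    by (rule finite_subset[OF _ finite_lists_length_eq[of "{1..r}" j]]) auto
  have "(\<Sum>js | length js = n \<and> sorted js \<and> set js \<subseteq> {1..Suc r}. F js) =
    (\<Sum>(j, js)\<in>(SIGMA j:{..n}. {js. length js = j \<and> sorted js \<and> set js \<subseteq> {1..r}}). F (js @ replicate (n - j) (Suc r)))"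
  proof (rule sum.reindex_bij_witness[of _ "\<lambda>(j, js). js @ replicate (n - j) (Suc r)"
        "\<lambda>js. (length (takeWhile (\<lambda>i. i \<le> r) js), takeWhile (\<lambda>i. i \<le> r) js)"])
    fix js assume "js \<in> {js. length js = n \<and> sorted js \<and> set js \<subseteq> {1..Suc r}}"
    then have js: "length js = n" "sorted js" "set js \<subseteq> {1..Suc r}" by auto
    let ?T = "takeWhile (\<lambda>i. i \<le> r) js" and ?D = "dropWhile (\<lambda>i. i \<le> r) js"
    have "x = Suc r" if "x \<in> set ?D" for x
    proof -
      from that obtain d ds where D: "?D = d # ds" by (cases ?D) auto
      have "sorted ?D" using js(2) by (simp add: sorted_dropWhile)
      then have "d \<le> x" using that D by auto
      moreover have "\<not> d \<le> r" using hd_dropWhile[of "\<lambda>i. i \<le> r" js] D by auto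
      ultimately show ?thesis using js(3) set_dropWhileD[OF that] by auto
    qed
    then have "?D = replicate (length ?D) (Suc r)" by (metis replicate_length_same)
    moreover have len: "length ?T + length ?D = n" using js(1) by (metis length_append takeWhile_dropWhile_id)
    ultimately have D: "?D = replicate (n - length ?T) (Suc r)" by (metis diff_add_inverse)
    show e: "(case (length ?T, ?T) of (j, js) \<Rightarrow> js @ replicate (n - j) (Suc r)) = js"
      using D takeWhile_dropWhile_id[of "\<lambda>i. i \<le> r" js] by simp
    show "(length ?T, ?T) \<in> (SIGMA j:{..n}. {js. length js = j \<and> sorted js \<and> set js \<subseteq> {1..r}})"
      using js len by (auto simp: sorted_takeWhile dest!: set_takeWhileD)
    show "(case (length ?T, ?T) of (j, js) \<Rightarrow> F (js @ replicate (n - j) (Suc r))) = F js"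
      using e by simp
  next
    fix p assume "p \<in> (SIGMA j:{..n}. {js. length js = j \<and> sorted js \<and> set js \<subseteq> {1..r}})"
    then obtain js where p: "p = (length js, js)" "length js \<le> n" "sorted js" "set js \<subseteq> {1..r}" by auto
    have "takeWhile (\<lambda>i. i \<le> r) (js @ replicate (n - length js) (Suc r)) = js @ takeWhile (\<lambda>i. i \<le> r) (replicate (n - length js) (Suc r))"
      using p(4) by (intro takeWhile_append2) auto
    moreover have "takeWhile (\<lambda>i. i \<le> r) (replicate m (Suc r)) = []" for m by (cases m) auto
    ultimately show "(length (takeWhile (\<lambda>i. i \<le> r) (case p of (j, js) \<Rightarrow> js @ replicate (n - j) (Suc r))),
        takeWhile (\<lambda>i. i \<le> r) (case p of (j, js) \<Rightarrow> js @ replicate (n - j) (Suc r))) = p"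
      using p(1) by simp
    show "(case p of (j, js) \<Rightarrow> js @ replicate (n - j) (Suc r)) \<in> {js. length js = n \<and> sorted js \<and> set js \<subseteq> {1..Suc r}}"
      using p by (fastforce simp: sorted_append)
  qed
  also have "\<dots> = (\<Sum>j\<le>n. \<Sum>js | length js = j \<and> sorted js \<and> set js \<subseteq> {1..r}. F (js @ replicate (n - j) (Suc r)))"
    by (rule sum.Sigma[symmetric]) (simp, blast intro: fin)
  finally show ?thesis .
qed

lemma A_split_Nil: "A_split \<omega> a b r h [] = 1"
proof -
  have "{js. length js = length [] \<and> sorted js \<and> set js \<subseteq> {1..r}} = {[]}" by auto
  then show ?thesis by (simp add: A_split_def)
qed

lemma alpha_split_eq: "alpha_split \<omega> a b r h w = complex_of_real (h ^ length w) * A_split \<omega> a b r h w"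
  by (cases "w = []") (simp_all add: alpha_split_def A_split_Nil)

lemma alpha_split_0: "alpha_split \<omega> a b 0 h = (\<lambda>w. if w = [] then 1 else 0)"
  by (auto simp: alpha_split_def A_split_def fun_eq_iff intro!: sum.neutral)

lemma sum_list_map_scaleR_zip_replicate:
  "sum_list (map (\<lambda>(j, k). C j *\<^sub>R freq k) (zip (replicate (length u) x) u)) = C x *\<^sub>R sum_list (map freq u)"
  by (induction u) (simp_all add: scaleR_add_right)

text \<open>
  Cut a word where the final run of \<open>Suc r\<close> in the list of stages begins. The run contributes
  \<open>b\<^bsub>r+1\<^esub>^m / m!\<close> and the phase of its letters at the angle \<open>c\<^bsub>r+1\<^esub> h \<omega>\<close>, which is what the last
  kick adds after the last rotation.
\<close>

lemma alpha_split_Suc: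
  fixes \<omega> :: "real^'d::finite"
  shows
  "alpha_split \<omega> a b (Suc r) h = compose_coeff (alpha_split \<omega> a b r h) ((h * (\<Sum>m=1..Suc r. a m)) *\<^sub>R \<omega>)
     (taylor_flow_coeff (b (Suc r) * h))"
proof
  fix w :: "(int^'d) list"
  let ?C = "\<lambda>j. \<Sum>m=1..j. a m" and ?n = "length w"
  let ?P = "\<lambda>j r. {js. length js = j \<and> sorted js \<and> set js \<subseteq> {1..r}}"
  let ?E = "\<lambda>js u. exp (\<i> * complex_of_real (((\<Sum>l<length u. ?C (js ! l) *\<^sub>R freq (u ! l)) \<bullet> \<omega>) * h))"
  let ?b = "\<lambda>js. complex_of_real (prod_list (map b js) / real (run_factorial js))"
  have key: "complex_of_real (h ^ ?n) * (?b (js @ replicate (?n - j) (Suc r)) * ?E (js @ replicate (?n - j) (Suc r)) w) =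
     complex_of_real (h ^ j) * (?b js * ?E js (take j w)) *
     (exp (\<i> * complex_of_real (sum_list (map freq (drop j w)) \<bullet> ((h * ?C (Suc r)) *\<^sub>R \<omega>))) * taylor_flow_coeff (b (Suc r) * h) (drop j w))"
    if j: "j \<le> ?n" and js: "js \<in> ?P j r" for j js
  proof -
    have len: "length js = length (take j w)" and x: "Suc r \<notin> set js" using js j by auto
    let ?R = "replicate (?n - j) (Suc r)" and ?z = "\<lambda>js u. sum_list (map (\<lambda>(j, k). ?C j *\<^sub>R freq k) (zip js u))"
    have "?z (js @ ?R) w = ?z (js @ ?R) (take j w @ drop j w)" by simp
    also have "\<dots> = ?z js (take j w) + ?z ?R (drop j w)"
      by (subst zip_append[OF len]) simp
    also have "?z ?R (drop j w) = ?C (Suc r) *\<^sub>R sum_list (map freq (drop j w))"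
      using sum_list_map_scaleR_zip_replicate[of ?C "drop j w"] by simp
    finally have "?z (js @ ?R) w \<bullet> \<omega> * h = ?z js (take j w) \<bullet> \<omega> * h + sum_list (map freq (drop j w)) \<bullet> ((h * ?C (Suc r)) *\<^sub>R \<omega>)"
      by (simp add: inner_add_left algebra_simps)
    moreover have "(\<Sum>l<length w. ?C ((js @ ?R) ! l) *\<^sub>R freq (w ! l)) = ?z (js @ ?R) w"
      by (rule sum_nth_eq_sum_list_zip) (use len j in simp)
    moreover have "(\<Sum>l<length (take j w). ?C (js ! l) *\<^sub>R freq (take j w ! l)) = ?z js (take j w)"
      by (rule sum_nth_eq_sum_list_zip[OF len])
    ultimately have E: "?E (js @ ?R) w = ?E js (take j w) *
         exp (\<i> * complex_of_real (sum_list (map freq (drop j w)) \<bullet> ((h * ?C (Suc r)) *\<^sub>R \<omega>)))"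
      by (simp only: of_real_add distrib_left exp_add)
    have B: "complex_of_real (h ^ ?n) * ?b (js @ ?R) = complex_of_real (h ^ j) * ?b js * taylor_flow_coeff (b (Suc r) * h) (drop j w)"
    proof -
      have "h ^ ?n = h ^ j * h ^ (?n - j)" using j by (simp add: power_add[symmetric])
      then show ?thesis
        unfolding run_factorial_append_replicate[OF x] taylor_flow_coeff_def
        by (simp add: prod_list_replicate power_mult_distrib field_simps)
    qed
    show ?thesis unfolding E using B by (simp only: mult.assoc[symmetric]) (simp only: mult.assoc mult.left_commute mult.commute)
  qed
  have "alpha_split \<omega> a b (Suc r) h w = (\<Sum>j\<le>?n. \<Sum>js\<in>?P j r. complex_of_real (h ^ ?n) * (?b (js @ replicate (?n - j) (Suc r)) * ?E (js @ replicate (?n - j) (Suc r)) w))"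
    unfolding alpha_split_eq A_split_def sum_sorted_lists_Suc sum_distrib_left ..
  also have "\<dots> = compose_coeff (alpha_split \<omega> a b r h) ((h * ?C (Suc r)) *\<^sub>R \<omega>) (taylor_flow_coeff (b (Suc r) * h)) w"
    unfolding compose_coeff_def alpha_split_eq A_split_def
  proof (rule sum.cong[OF refl])
    fix j assume "j \<in> {..?n}"
    then have j: "j \<le> ?n" by simp
    then have l: "length (take j w) = j" by simp
    define Q where "Q = exp (\<i> * complex_of_real (sum_list (map freq (drop j w)) \<bullet> ((h * ?C (Suc r)) *\<^sub>R \<omega>))) *
      taylor_flow_coeff (b (Suc r) * h) (drop j w)"
    have "(\<Sum>js\<in>?P j r. complex_of_real (h ^ ?n) * (?b (js @ replicate (?n - j) (Suc r)) * ?E (js @ replicate (?n - j) (Suc r)) w)) =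
      (\<Sum>js\<in>?P j r. complex_of_real (h ^ j) * (?b js * ?E js (take j w)) * Q)"
      unfolding Q_def using key[OF j] by (intro sum.cong refl) blast
    also have "\<dots> = complex_of_real (h ^ j) * (\<Sum>js\<in>?P j r. ?b js * ?E js (take j w)) * Q"
      by (simp only: sum_distrib_right[symmetric] sum_distrib_left[symmetric])
    finally show "(\<Sum>js\<in>?P j r. complex_of_real (h ^ ?n) * (?b (js @ replicate (?n - j) (Suc r)) * ?E (js @ replicate (?n - j) (Suc r)) w)) =
      complex_of_real (h ^ length (take j w)) * (\<Sum>js\<in>?P (length (take j w)) r. ?b js * ?E js (take j w)) *
      (exp (\<i> * complex_of_real (sum_list (map freq (drop j w)) \<bullet> ((h * ?C (Suc r)) *\<^sub>R \<omega>))) * taylor_flow_coeff (b (Suc r) * h) (drop j w))"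
      unfolding l Q_def .
  qed
  finally show "alpha_split \<omega> a b (Suc r) h w = compose_coeff (alpha_split \<omega> a b r h) ((h * ?C (Suc r)) *\<^sub>R \<omega>) (taylor_flow_coeff (b (Suc r) * h)) w" .
qed

section \<open>Coefficients of the exact flow\<close>

text \<open>
  The iterated integral on \<open>[0,t]\<close> for the word read backwards: the letter at the head belongs to the
  outermost, that is largest, integration variable.
\<close>

primrec exact_coeff :: "real^'d::finite \<Rightarrow> (int^'d) list \<Rightarrow> real \<Rightarrow> complex" where
  "exact_coeff \<omega> [] t = 1"
| "exact_coeff \<omega> (k # w) t =
     (LBINT s=0..t. exp (\<i> * complex_of_real (s * (freq k \<bullet> \<omega>))) * exact_coeff \<omega> w s)"

lemma exact_coeff_derivative_aux:
  assumes c: "continuous_on UNIV (exact_coeff \<omega> w)"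
  shows "(exact_coeff \<omega> (k # w) has_vector_derivative
     exp (\<i> * complex_of_real (t * (freq k \<bullet> \<omega>))) * exact_coeff \<omega> w t) (at t)"
proof -
  let ?g = "\<lambda>s. exp (\<i> * complex_of_real (s * (freq k \<bullet> \<omega>))) * exact_coeff \<omega> w s"
  \<comment> \<open>An interval that has both \<open>0\<close> and \<open>t\<close> in its interior, so that the one-sided restriction disappears.\<close>
  define R where "R = \<bar>t\<bar> + 1"
  have "continuous_on {-R..R} ?g"
    by (intro continuous_intros continuous_on_subset[OF c]) auto
  then have "((\<lambda>u. LBINT s=0..u. ?g s) has_vector_derivative ?g t) (at t within {-R..R})"
    by (intro interval_integral_FTC2[of "-R" 0 R, unfolded zero_ereal_def[symmetric]]) (auto simp: R_def)
  moreover have "at t within {-R..R} = at t"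
    by (rule at_within_Icc_at) (auto simp: R_def)
  moreover have "exact_coeff \<omega> (k # w) = (\<lambda>u. LBINT s=0..u. ?g s)" by (rule ext) simp
  ultimately show ?thesis by (simp only:)
qed

lemma continuous_exact_coeff: "continuous_on UNIV (exact_coeff \<omega> w)"
proof (induction w)
  case Nil
  then show ?case by simp
next
  case (Cons k w)
  show ?case
    by (rule continuous_at_imp_continuous_on) (blast intro: has_vector_derivative_continuous exact_coeff_derivative_aux[OF Cons])
qed

lemma exact_coeff_derivative:
  "(exact_coeff \<omega> (k # w) has_vector_derivative
     exp (\<i> * complex_of_real (t * (freq k \<bullet> \<omega>))) * exact_coeff \<omega> w t) (at t)"
  by (rule exact_coeff_derivative_aux[OF continuous_exact_coeff])

lemma exact_coeff_0: "w \<noteq> [] \<Longrightarrow> exact_coeff \<omega> w 0 = 0"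
  by (cases w) (simp_all add: zero_ereal_def)

text \<open>
  The upper bound \<open>\<tau>\<close> is variable because fixing the largest coordinate leaves an ordered simplex
  that it bounds.
\<close>

definition scaled_simplex :: "real \<Rightarrow> nat \<Rightarrow> (nat \<Rightarrow> real) set" where
  "scaled_simplex \<tau> n = {t \<in> space (\<Pi>\<^sub>M j\<in>{..<n}. lborel).
     (\<forall>j<n. 0 \<le> t j \<and> t j \<le> \<tau>) \<and> (\<forall>i<n. \<forall>j<n. i \<le> j \<longrightarrow> t i \<le> t j)}"

definition simplex_integrand :: "real^'d::finite \<Rightarrow> real \<Rightarrow> (int^'d) list \<Rightarrow> real \<Rightarrow> (nat \<Rightarrow> real) \<Rightarrow> complex" where
  "simplex_integrand \<omega> h w \<tau> t = indicator (scaled_simplex \<tau> (length w)) t *\<^sub>R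
     exp (\<i> * complex_of_real (((\<Sum>j<length w. t j *\<^sub>R freq (w ! j)) \<bullet> \<omega>) * h))"

lemma component_measurable:
  "j < n \<Longrightarrow> (\<lambda>t. t j) \<in> borel_measurable (\<Pi>\<^sub>M j\<in>{..<n}. (lborel :: real measure))"
  using measurable_component_singleton[of j "{..<n}" "\<lambda>_. lborel :: real measure"] by simp

lemma scaled_simplex_sets: "scaled_simplex \<tau> n \<in> sets (\<Pi>\<^sub>M j\<in>{..<n}. (lborel :: real measure))"
proof -
  let ?M = "\<Pi>\<^sub>M j\<in>{..<n}. (lborel :: real measure)"
  have "scaled_simplex \<tau> n = {t \<in> space ?M. (\<forall>j\<in>{..<n}. 0 \<le> t j \<and> t j \<le> \<tau>) \<and> (\<forall>i\<in>{..<n}. \<forall>j\<in>{i..<n}. t i \<le> t j)}"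
    by (auto simp: scaled_simplex_def)
  also have "\<dots> \<in> sets ?M"
    by (intro sets.sets_Collect_conj sets.sets_Collect_finite_All borel_measurable_le component_measurable) auto
  finally show ?thesis .
qed

lemma simplex_integrand_measurable:
  "simplex_integrand \<omega> h w \<tau> \<in> borel_measurable (\<Pi>\<^sub>M j\<in>{..<length w}. lborel)"
proof -
  have "(\<lambda>t. ((\<Sum>j<length w. t j *\<^sub>R freq (w ! j)) \<bullet> \<omega>) * h) \<in> borel_measurable (\<Pi>\<^sub>M j\<in>{..<length w}. lborel)"
    by (intro borel_measurable_times borel_measurable_inner borel_measurable_sum borel_measurable_scaleR
        borel_measurable_const component_measurable) simp
  then have "(\<lambda>t. exp (\<i> * complex_of_real (((\<Sum>j<length w. t j *\<^sub>R freq (w ! j)) \<bullet> \<omega>) * h))) \<in>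
      borel_measurable (\<Pi>\<^sub>M j\<in>{..<length w}. lborel)"
    by (intro borel_measurable_continuous_on[of exp] borel_measurable_times borel_measurable_const
        borel_measurable_continuous_on[of complex_of_real]) (auto intro: continuous_intros)
  then show ?thesis unfolding simplex_integrand_def[abs_def]
    by (intro borel_measurable_scaleR borel_measurable_indicator scaled_simplex_sets)
qed

lemma norm_simplex_integrand: "norm (simplex_integrand \<omega> h w \<tau> t) \<le> 1"
  by (simp add: simplex_integrand_def indicator_def)

lemma simplex_integrand_outside:
  assumes "\<tau> \<le> 1" "t \<notin> (\<Pi>\<^sub>E j\<in>{..<length w}. {0..1})"
  shows "simplex_integrand \<omega> h w \<tau> t = 0"
proof -
  have "t \<notin> scaled_simplex \<tau> (length w)"
    using assms by (force simp: scaled_simplex_def space_PiM PiE_def Pi_def)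
  then show ?thesis by (simp add: simplex_integrand_def)
qed

interpretation lborel_product: product_sigma_finite "\<lambda>_::nat. lborel :: real measure" ..

lemma simplex_integrand_snoc:
  assumes "t \<in> space (\<Pi>\<^sub>M j\<in>{..<length w}. lborel)"
  shows "simplex_integrand \<omega> h (w @ [k]) \<tau> (t(length w := y)) =
    indicator {0..\<tau>} y *\<^sub>R (exp (\<i> * complex_of_real (h * y * (freq k \<bullet> \<omega>))) * simplex_integrand \<omega> h w y t)"
proof -
  let ?n = "length w" and ?t = "t(length w := y)"
  have "?t \<in> space (\<Pi>\<^sub>M j\<in>{..<Suc ?n}. lborel)"
    using assms by (auto simp: space_PiM PiE_def extensional_def)
  then have "?t \<in> scaled_simplex \<tau> (Suc ?n) \<longleftrightarrow> y \<in> {0..\<tau>} \<and> t \<in> scaled_simplex y ?n"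
    using assms by (fastforce simp: scaled_simplex_def less_Suc_eq)
  moreover have "(\<Sum>j<?n. ?t j *\<^sub>R freq ((w @ [k]) ! j)) = (\<Sum>j<?n. t j *\<^sub>R freq (w ! j))"
    by (intro sum.cong refl) (simp add: nth_append)
  then have "((\<Sum>j<Suc ?n. ?t j *\<^sub>R freq ((w @ [k]) ! j)) \<bullet> \<omega>) * h = h * y * (freq k \<bullet> \<omega>) + ((\<Sum>j<?n. t j *\<^sub>R freq (w ! j)) \<bullet> \<omega>) * h"
    by (simp add: inner_add_left algebra_simps)
  ultimately show ?thesis
    unfolding simplex_integrand_def by (auto simp: indicator_def exp_add distrib_left simp del: sum.lessThan_Suc)
qed

text \<open>
  Fubini with the last coordinate as the outer variable. All integrands are bounded by \<open>1\<close> and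
  vanish outside the unit cube, which settles integrability.
\<close>

lemma simplex_integral_snoc:
  assumes "\<tau> \<le> 1"
  shows "(LINT t|(\<Pi>\<^sub>M j\<in>{..<Suc (length w)}. lborel). simplex_integrand \<omega> h (w @ [k]) \<tau> t) =
    (LINT y|lborel. indicator {0..\<tau>} y *\<^sub>R (exp (\<i> * complex_of_real (h * y * (freq k \<bullet> \<omega>))) *
       (LINT t|(\<Pi>\<^sub>M j\<in>{..<length w}. lborel). simplex_integrand \<omega> h w y t)))"
proof -
  let ?n = "length w" and ?F = "simplex_integrand \<omega> h (w @ [k]) \<tau>"
  let ?M = "\<lambda>n::nat. \<Pi>\<^sub>M j\<in>{..<n}. (lborel :: real measure)"
  have meas: "?F \<in> borel_measurable (?M (Suc ?n))"
    using simplex_integrand_measurable[of \<omega> h "w @ [k]" \<tau>] by simp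
  have cube: "emeasure (?M n) (\<Pi>\<^sub>E j\<in>{..<n}. {0..1::real}) = 1" for n
    using lborel_product.emeasure_PiM[of "{..<n}" "\<lambda>_. {0..1::real}"] by simp
  have cube': "(\<Pi>\<^sub>E j\<in>{..<n}. {0..1::real}) \<in> sets (?M n)" for n
    by (rule sets_PiM_I_finite) auto
  have ins: "{..<Suc ?n} = insert ?n {..<?n}" by auto
  have int: "integrable (?M (Suc ?n)) ?F"
  proof (rule integrableI_bounded_set[where A="\<Pi>\<^sub>E j\<in>{..<Suc ?n}. {0..1}" and B=1])
    show "AE x in ?M (Suc ?n). x \<in> (\<Pi>\<^sub>E j\<in>{..<Suc ?n}. {0..1::real}) \<longrightarrow> norm (?F x) \<le> 1"
      by (simp add: norm_simplex_integrand)
  qed (use assms cube[of "Suc ?n"] cube'[of "Suc ?n"] meas simplex_integrand_outside[of \<tau> _ "w @ [k]"] in auto)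
  let ?f = "\<lambda>(t, y). ?F (t(?n := y))"
  have add: "(\<lambda>(t, y). t(?n := y)) \<in> measurable (?M ?n \<Otimes>\<^sub>M lborel) (?M (Suc ?n))"
    unfolding ins by (rule measurable_add_dim)
  have measf: "?f \<in> borel_measurable (?M ?n \<Otimes>\<^sub>M lborel)"
    using measurable_compose[OF add meas] by (simp add: case_prod_beta')
  have intf: "integrable (?M ?n \<Otimes>\<^sub>M lborel) ?f"
  proof (rule integrableI_bounded_set[where A="(\<Pi>\<^sub>E j\<in>{..<?n}. {0..1::real}) \<times> {0..1::real}" and B=1])
    show "emeasure (?M ?n \<Otimes>\<^sub>M lborel) ((\<Pi>\<^sub>E j\<in>{..<?n}. {0..1::real}) \<times> {0..1::real}) < \<infinity>"
      by (subst sigma_finite_measure.emeasure_pair_measure_Times[OF sigma_finite_lborel]) (simp_all add: cube cube')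
    show "AE p in ?M ?n \<Otimes>\<^sub>M lborel. p \<in> (\<Pi>\<^sub>E j\<in>{..<?n}. {0..1::real}) \<times> {0..1::real} \<longrightarrow> norm (?f p) \<le> 1"
      by (simp add: norm_simplex_integrand case_prod_beta)
    show "AE p in ?M ?n \<Otimes>\<^sub>M lborel. p \<notin> (\<Pi>\<^sub>E j\<in>{..<?n}. {0..1::real}) \<times> {0..1::real} \<longrightarrow> ?f p = 0"
    proof (rule AE_I2, rule impI)
      fix p assume p: "p \<in> space (?M ?n \<Otimes>\<^sub>M lborel)" "p \<notin> (\<Pi>\<^sub>E j\<in>{..<?n}. {0..1::real}) \<times> {0..1::real}"
      obtain t y where ty: "p = (t, y)" by (cases p)
      with p have "t \<in> extensional {..<?n}" by (simp add: space_pair_measure space_PiM PiE_def)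
      with p(2) ty have "t(?n := y) \<notin> (\<Pi>\<^sub>E j\<in>{..<Suc ?n}. {0..1::real})"
        by (auto simp: PiE_def Pi_def less_Suc_eq)
      then show "?f p = 0" using simplex_integrand_outside[OF assms, of "t(?n := y)" "w @ [k]"] ty by simp
    qed
  qed (use measf cube' in auto)
  interpret pair_sigma_finite "?M ?n" lborel
    by (intro pair_sigma_finite.intro lborel_product.sigma_finite sigma_finite_lborel) simp
  have "(LINT t|?M (Suc ?n). ?F t) = (LINT t|?M ?n. LINT y|lborel. ?F (t(?n := y)))"
    using lborel_product.product_integral_insert[of "{..<?n}" ?n ?F] int unfolding ins by simp
  also have "\<dots> = (LINT y|lborel. LINT t|?M ?n. ?F (t(?n := y)))"
    using Fubini_integral[OF intf] by simp
  also have "\<dots> = (LINT y|lborel. LINT t|?M ?n. indicator {0..\<tau>} y *\<^sub>R (exp (\<i> * complex_of_real (h * y * (freq k \<bullet> \<omega>))) * simplex_integrand \<omega> h w y t))"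
    by (intro Bochner_Integration.integral_cong refl simplex_integrand_snoc)
  finally show ?thesis by simp
qed

text \<open>
  Substituting \<open>s = h y\<close> in the outer integral turns one factor \<open>h\<close> and the integral over \<open>[0,\<tau>]\<close>
  into one over \<open>[0,h \<tau>]\<close>. Doing this through the fundamental theorem of calculus covers every sign
  of \<open>h\<close>.
\<close>

lemma simplex_integral_eq_exact_coeff:
  assumes "0 \<le> \<tau>" "\<tau> \<le> 1"
  shows "complex_of_real (h ^ length w) * (LINT t|(\<Pi>\<^sub>M j\<in>{..<length w}. lborel). simplex_integrand \<omega> h w \<tau> t) =
    exact_coeff \<omega> (rev w) (h * \<tau>)"
  using assms
proof (induction w arbitrary: \<tau> rule: rev_induct)
  case Nil
  have "scaled_simplex \<tau> 0 = {\<lambda>_. undefined}" by (auto simp: scaled_simplex_def space_PiM)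
  then show ?case by (simp add: simplex_integrand_def PiM_empty lebesgue_integral_count_space_finite)
next
  case (snoc k w)
  let ?e = "\<lambda>y. exp (\<i> * complex_of_real (h * y * (freq k \<bullet> \<omega>)))"
  let ?g = "\<lambda>y. h *\<^sub>R (?e y * exact_coeff \<omega> (rev w) (h * y))"
  let ?I = "\<lambda>y. LINT t|(\<Pi>\<^sub>M j\<in>{..<length w}. lborel). simplex_integrand \<omega> h w y t"
  have "complex_of_real (h ^ Suc (length w)) * (LINT y|lborel. indicator {0..\<tau>} y *\<^sub>R (?e y * ?I y)) =
     (LINT y|lborel. indicator {0..\<tau>} y *\<^sub>R (h *\<^sub>R (?e y * (complex_of_real (h ^ length w) * ?I y))))"
    by (subst integral_mult_right_zero[symmetric]) (simp add: scaleR_conv_of_real mult_ac)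
  also have "\<dots> = (LINT y|lborel. indicator {0..\<tau>} y *\<^sub>R ?g y)"
    using snoc by (intro Bochner_Integration.integral_cong refl) (auto simp: indicator_def)
  also have "\<dots> = exact_coeff \<omega> (k # rev w) (h * \<tau>) - exact_coeff \<omega> (k # rev w) (h * 0)"
  proof (rule integral_FTC_atLeastAtMost[OF snoc.prems(1)])
    fix y
    have "((\<lambda>y. h * y) has_vector_derivative h) (at y within {0..\<tau>})"
      by (auto intro!: derivative_eq_intros simp: has_real_derivative_iff_has_vector_derivative[symmetric])
    from vector_diff_chain_within[OF this has_vector_derivative_at_within[OF exact_coeff_derivative[of \<omega> k "rev w" "h * y"]]]
    show "((\<lambda>y. exact_coeff \<omega> (k # rev w) (h * y)) has_vector_derivative ?g y) (at y within {0..\<tau>})"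
      by (simp add: o_def del: exact_coeff.simps)
  next
    show "continuous_on {0..\<tau>} ?g"
      by (intro continuous_intros continuous_on_compose2[OF continuous_exact_coeff]) auto
  qed
  finally show ?case
    using simplex_integral_snoc[OF snoc.prems(2), where \<omega>=\<omega> and h=h and w=w and k=k] by (simp add: exact_coeff_0 del: exact_coeff.simps(2))
qed

lemma alpha_exact_eq: "alpha_exact \<omega> h w = exact_coeff \<omega> (rev w) h"
proof -
  have "ordered_simplex n = scaled_simplex 1 n" for n
    by (simp add: ordered_simplex_def scaled_simplex_def)
  then have "A_exact \<omega> h w = (LINT t|(\<Pi>\<^sub>M j\<in>{..<length w}. lborel). simplex_integrand \<omega> h w 1 t)"
    by (simp add: A_exact_def set_lebesgue_integral_def simplex_integrand_def)
  then show ?thesis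
    using simplex_integral_eq_exact_coeff[of 1 h w \<omega>] by (auto simp: alpha_exact_def)
qed

lemma alpha_exact_Nil: "alpha_exact \<omega> h [] = 1" by (simp add: alpha_exact_def)

lemma alpha_exact_0: "w \<noteq> [] \<Longrightarrow> alpha_exact \<omega> 0 w = 0"
  by (simp add: alpha_exact_eq exact_coeff_0)

lemma alpha_exact_derivative:
  "((\<lambda>t. alpha_exact \<omega> t (w @ [k])) has_vector_derivative
     exp (\<i> * complex_of_real (t * (freq k \<bullet> \<omega>))) * alpha_exact \<omega> t w) (at t)"
  unfolding alpha_exact_eq using exact_coeff_derivative[of \<omega> k "rev w" t] by (simp del: exact_coeff.simps)

lemma alpha_exact_eq_power: "alpha_exact \<omega> h w = complex_of_real (h ^ length w) * A_exact \<omega> h w"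
proof (cases "w = []")
  case True
  have "ordered_simplex 0 = scaled_simplex 1 0" 
    by (simp add: ordered_simplex_def scaled_simplex_def)
  then show ?thesis
    using simplex_integral_eq_exact_coeff[of 1 h "[] :: (int^'a) list" \<omega>] True
    by (simp add: alpha_exact_def A_exact_def set_lebesgue_integral_def simplex_integrand_def)
qed (simp add: alpha_exact_def)

section \<open>The local error\<close>

lemma fexp_id_eq_word_series: "fexp_id = word_series \<iota> f (cvec 0) (\<lambda>w. if w = [] then 1 else 0)"
proof (intro ext)
  fix M x
  have "angle_vec \<iota> (cvec (0 :: real^'a)) = 0" by (simp add: angle_vec_def cvec_def vec_eq_iff)
  then show "fexp_id M x = word_series \<iota> f (cvec 0) (\<lambda>w. if w = [] then 1 else 0) M x"
    unfolding word_series_eq word_sum_unit fexp_id_def by simp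
qed

lemma rotation_flow_eq:
  assumes "inj \<iota>" "smooth f" "formal_flow (rotation_field \<iota> \<omega>) \<Phi>"
  shows "\<Phi> t = word_series \<iota> f (cvec (t *\<^sub>R \<omega>)) (\<lambda>w. if w = [] then 1 else 0)"
  by (rule formal_flow_eq_word_series[where a=0 and \<delta>="\<lambda>t w. if w = [] then 1 else 0", OF assms(1,2)])
     (use assms(3) in \<open>simp_all add: eta_contract_eq\<close>)

lemma perturbation_flow_eq:
  assumes "inj \<iota>" "smooth f" "formal_flow (perturbation_field \<iota> f) \<Phi>"
  shows "\<Phi> t = word_series \<iota> f (cvec 0) (taylor_flow_coeff t)"
proof -
  have "perturbation_field \<iota> f = (\<lambda>M x. rotation_field \<iota> 0 M x + 1 *s perturbation_field \<iota> f M x)"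
    by (simp add: rotation_field_def angle_vec_def cvec_def vec_eq_iff fun_eq_iff)
  with assms(3) have "formal_flow (\<lambda>M x. rotation_field \<iota> 0 M x + 1 *s perturbation_field \<iota> f M x) \<Phi>" by simp
  from formal_flow_eq_word_series[where \<delta>=taylor_flow_coeff, OF assms(1,2) this, of t]
  show ?thesis by (simp add: taylor_flow_coeff_derivative)
qed

lemma full_flow_eq:
  assumes "inj \<iota>" "smooth f" "formal_flow (full_field \<iota> \<omega> f) \<Phi>"
  shows "\<Phi> t = word_series \<iota> f (cvec (t *\<^sub>R \<omega>)) (alpha_exact \<omega> t)"
proof (rule formal_flow_eq_word_series[where a=1 and \<delta>="alpha_exact \<omega>", OF assms(1,2)])
  show "formal_flow (\<lambda>M x. rotation_field \<iota> \<omega> M x + 1 *s perturbation_field \<iota> f M x) \<Phi>"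
    using assms(3) by (simp add: full_field_def[abs_def])
  show "((\<lambda>t. alpha_exact \<omega> t (w @ [k])) has_vector_derivative
       1 * exp (\<i> * complex_of_real (t * (freq k \<bullet> \<omega>))) * alpha_exact \<omega> t w) (at t)" for t w k
    unfolding mult_1 by (rule alpha_exact_derivative)
qed (simp_all add: alpha_exact_Nil alpha_exact_0)

text \<open>
  Every stage is the composition with one rotation and one kick. The rotation moves only the angle
  part. The kick multiplies the coefficients by those of a Taylor flow, and letting its
  duration grow from \<open>0\<close> shows that the new coefficients are again substitutive.
\<close>

lemma splitting_eq_word_series:
  assumes \<iota>: "inj \<iota>" and f: "smooth f"
    and U: "formal_flow (rotation_field \<iota> \<omega>) \<Phi>U" and P: "formal_flow (perturbation_field \<iota> f) \<Phi>P"
  shows "splitting \<Phi>U \<Phi>P a b h r = word_series \<iota> f (cvec ((h * (\<Sum>j=1..r. a j)) *\<^sub>R \<omega>)) (alpha_split \<omega> a b r h) \<and>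
    (\<forall>x. substitutive \<iota> f (alpha_split \<omega> a b r h) x)"
proof (induction r)
  case 0
  then show ?case by (simp add: alpha_split_0 substitutive_unit fexp_id_eq_word_series[of \<iota> f])
next
  case (Suc r)
  let ?\<delta> = "alpha_split \<omega> a b r h" and ?v = "\<lambda>r. (h * (\<Sum>j=1..r. a j)) *\<^sub>R \<omega>"
  have \<delta>: "?\<delta> [] = 1" by (simp add: alpha_split_def)
  have sub: "substitutive \<iota> f ?\<delta> x" for x using Suc by blast
  have v: "?v r + (a (Suc r) * h) *\<^sub>R \<omega> = ?v (Suc r)"
    by (simp add: algebra_simps)
  have "fexp_subst (\<Phi>U (a (Suc r) * h)) (splitting \<Phi>U \<Phi>P a b h r) = word_series \<iota> f (cvec (?v (Suc r))) ?\<delta>"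
    unfolding rotation_flow_eq[OF \<iota> f U] conjunct1[OF Suc] fexp_subst_word_series[of \<iota> f ?\<delta> "\<lambda>w. if w = [] then 1 else 0", OF \<iota> f \<delta> sub if_P[OF refl]] compose_coeff_unit v ..
  moreover have "fexp_subst (\<Phi>P (b (Suc r) * h)) (word_series \<iota> f (cvec (?v (Suc r))) ?\<delta>) =
     word_series \<iota> f (cvec (?v (Suc r))) (alpha_split \<omega> a b (Suc r) h)"
    unfolding perturbation_flow_eq[OF \<iota> f P] alpha_split_Suc
      fexp_subst_word_series[of \<iota> f ?\<delta> "taylor_flow_coeff (b (Suc r) * h)", OF \<iota> f \<delta> sub taylor_flow_coeff_simps(1)] by simp
  moreover have "substitutive \<iota> f (alpha_split \<omega> a b (Suc r) h) x" for x
    unfolding alpha_split_Suc by (rule substitutive_compose[OF f \<delta> sub])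
  ultimately show ?case by simp
qed

lemma word_series_diff:
  "word_series \<iota> f (cvec v) \<delta> M x - word_series \<iota> f (cvec v') \<delta>' M x =
   word_series \<iota> f (cvec (v - v')) (\<lambda>w. \<delta> w - \<delta>' w) M x"
proof -
  have "angle_vec \<iota> (cvec v) - angle_vec \<iota> (cvec v') = angle_vec \<iota> (cvec (v - v'))"
    by (simp add: angle_vec_def cvec_def vec_eq_iff)
  then show ?thesis
    by (simp add: word_series_def vec.scale_left_diff_distrib sum_subtractf)
qed

theorem theorem3:
  fixes \<iota> :: "'d::finite \<Rightarrow> 'n::finite"
    and \<omega> :: "real^'d"
    and f :: "real^'n \<Rightarrow> real^'n"
    and a b :: "nat \<Rightarrow> real"
    and r :: nat
    and h :: real
    and \<Phi> \<Phi>U \<Phi>P :: "real \<Rightarrow> ('d, 'n) fexp"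
  assumes "inj \<iota>"
    and "\<And>j. \<omega> $ j > 0"
    and "smooth f"
    and "angle_periodic \<iota> f"
    and "formal_flow (full_field \<iota> \<omega> f) \<Phi>"
    and "formal_flow (rotation_field \<iota> \<omega>) \<Phi>U"
    and "formal_flow (perturbation_field \<iota> f) \<Phi>P"
  shows "(\<lambda>M x. splitting \<Phi>U \<Phi>P a b h r M x - \<Phi> h M x) =
           word_series \<iota> f (cvec ((h * ((\<Sum>j=1..r. a j) - 1)) *\<^sub>R \<omega>))
             (\<lambda>w. alpha_split \<omega> a b r h w - alpha_exact \<omega> h w) \<and>
         (\<forall>M x. splitting \<Phi>U \<Phi>P a b h r M x - \<Phi> h M x =
           (if M = {#} then angle_vec \<iota> (cvec ((h * ((\<Sum>j=1..r. a j) - 1)) *\<^sub>R \<omega>))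
            else complex_of_real (h ^ size M) *s
              (\<Sum>w | mset w = M. (A_split \<omega> a b r h w - A_exact \<omega> h w) *s word_fun \<iota> f w x)))"
proof -
  let ?v = "(h * ((\<Sum>j=1..r. a j) - 1)) *\<^sub>R \<omega>"
  have v: "(h * (\<Sum>j=1..r. a j)) *\<^sub>R \<omega> - h *\<^sub>R \<omega> = ?v"
    by (simp add: algebra_simps)
  have diff: "splitting \<Phi>U \<Phi>P a b h r M x - \<Phi> h M x =
      word_series \<iota> f (cvec ?v) (\<lambda>w. alpha_split \<omega> a b r h w - alpha_exact \<omega> h w) M x" for M x
    unfolding conjunct1[OF splitting_eq_word_series[OF assms(1,3,6,7)]] full_flow_eq[OF assms(1,3,5)]
      word_series_diff v ..
  have "word_series \<iota> f (cvec ?v) (\<lambda>w. alpha_split \<omega> a b r h w - alpha_exact \<omega> h w) M x =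
      (if M = {#} then angle_vec \<iota> (cvec ?v)
       else complex_of_real (h ^ size M) *s
         (\<Sum>w | mset w = M. (A_split \<omega> a b r h w - A_exact \<omega> h w) *s word_fun \<iota> f w x))" for M x
  proof (cases "M = {#}")
    case True
    then show ?thesis by (simp add: word_series_eq word_sum_empty alpha_split_def alpha_exact_def)
  next
    case False
    have "(alpha_split \<omega> a b r h w - alpha_exact \<omega> h w) *s word_fun \<iota> f w x =
        complex_of_real (h ^ size M) *s ((A_split \<omega> a b r h w - A_exact \<omega> h w) *s word_fun \<iota> f w x)"
      if "mset w = M" for w
      unfolding alpha_split_eq alpha_exact_eq_power size_mset[of w, unfolded that] vector_smult_assoc right_diff_distrib ..
    then have "(\<Sum>w | mset w = M. (alpha_split \<omega> a b r h w - alpha_exact \<omega> h w) *s word_fun \<iota> f w x) =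
        complex_of_real (h ^ size M) *s (\<Sum>w | mset w = M. (A_split \<omega> a b r h w - A_exact \<omega> h w) *s word_fun \<iota> f w x)"
      unfolding vec.scale_sum_right by (intro sum.cong refl) blast
    then show ?thesis using False by (simp only: word_series_def if_False add_0)
  qed
  then show ?thesis using diff by (simp only: fun_eq_iff) blast
qed

end
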